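(* Let $T$ be a perfect binary tree of height $h>0$ with vertex set $\{x_1,\dots,x_n\}$, let $S=\mathbb K[x_1,\dots,x_n]$ be the polynomial ring over a field $\mathbb K$, and let $I\subseteq S$ be the edge ideal of $T$. Let $m\ge 0$ be an integer. Then: (1) If $h=3m$, then $\operatorname{pd}_S(S/I)=\dfrac{10(8^m-1)}{7}$. (2) If $h=3m+1$, then $\operatorname{pd}_S(S/I)=\dfrac{20\cdot 8^m-6}{7}$. (3) If $h=3m+2$, then $\operatorname{pd}_S(S/I)=\dfrac{40\cdot 8^m-5}{7}$.
   Context: A perfect binary tree is a rooted tree in which every non-leaf vertex has exactly two children and all leaves lie at the same distance (number of edges) from the root; this common distance is the height $h$ of the tree. It is regarded as a finite simple graph. For a finite simple graph $G$ with vertices $x_1,\dots,x_n$ (identified with the variables of $S$), the edge ideal is $I(G)=(x_ix_j : \{x_i,x_j\}\in E(G))\subseteq S$. $\operatorname{pd}_S(M)$ denotes the projective dimension of a finitely generated graded $S$-module $M$, i.e. the length of its minimal graded free resolution. *)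

theory Defs
  imports
    "HOL-Library.Poly_Mapping"
    "HOL-Algebra.QuotRing"
    "Jordan_Normal_Form.VS_Connect"
    "Jordan_Normal_Form.Matrix_Kernel"
begin

section \<open>Perfect binary trees\<close>

text \<open>
  A graph on a finite vertex type \<open>'v\<close> (every element of the type is a vertex) is given by
  its set of edges, each edge being a two-element set of vertices.
\<close>

definition simple_graph :: "'v::finite set set \<Rightarrow> bool" where
  "simple_graph E \<longleftrightarrow> (\<forall>e\<in>E. card e = 2)"

definition walk :: "'v::finite set set \<Rightarrow> 'v list \<Rightarrow> bool" where
  "walk E xs \<longleftrightarrow> xs \<noteq> [] \<and> successively (\<lambda>u v. {u, v} \<in> E) xs"

definition walk_betw :: "'v::finite set set \<Rightarrow> 'v \<Rightarrow> 'v list \<Rightarrow> 'v \<Rightarrow> bool" where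
  "walk_betw E u xs v \<longleftrightarrow> walk E xs \<and> hd xs = u \<and> last xs = v"

definition connected_graph :: "'v::finite set set \<Rightarrow> bool" where
  "connected_graph E \<longleftrightarrow> (\<forall>u v. \<exists>xs. walk_betw E u xs v)"

text \<open>A cycle is listed without repeating its first vertex at the end.\<close>

definition graph_cycle :: "'v::finite set set \<Rightarrow> 'v list \<Rightarrow> bool" where
  "graph_cycle E xs \<longleftrightarrow>
     walk E xs \<and> distinct xs \<and> 3 \<le> length xs \<and> {last xs, hd xs} \<in> E"

text \<open>
  The predicate \<open>tree\<close> of the entry \<open>Graph_Theory\<close> concerns directed graphs and
  excludes directed cycles only, so it is not the notion of an undirected tree.
\<close>

definition tree_graph :: "'v::finite set set \<Rightarrow> bool" where
  "tree_graph E \<longleftrightarrow> simple_graph E \<and> connected_graph E \<and> (\<nexists>xs. graph_cycle E xs)"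

definition graph_dist :: "'v::finite set set \<Rightarrow> 'v \<Rightarrow> 'v \<Rightarrow> nat" where
  "graph_dist E u v = (LEAST k. \<exists>xs. walk_betw E u xs v \<and> length xs = Suc k)"

definition children :: "'v::finite set set \<Rightarrow> 'v \<Rightarrow> 'v \<Rightarrow> 'v set" where
  "children E r v = {w. {v, w} \<in> E \<and> graph_dist E r w = Suc (graph_dist E r v)}"

definition leaf :: "'v::finite set set \<Rightarrow> 'v \<Rightarrow> 'v \<Rightarrow> bool" where
  "leaf E r v \<longleftrightarrow> children E r v = {}"

definition perfect_binary_tree :: "'v::finite set set \<Rightarrow> 'v \<Rightarrow> nat \<Rightarrow> bool" where
  "perfect_binary_tree E r h \<longleftrightarrow>
     tree_graph E \<and>
     (\<forall>v. \<not> leaf E r v \<longrightarrow> card (children E r v) = 2) \<and>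
     (\<forall>v. leaf E r v \<longrightarrow> graph_dist E r v = h)"

section \<open>The polynomial ring and edge ideals\<close>

text \<open>
  The polynomial ring over \<open>'k\<close> whose variables are the elements of \<open>'v\<close>:
  finitely supported functions from exponent vectors to coefficients, with the convolution
  product of \<^theory>\<open>HOL-Library.Poly_Mapping\<close>.
\<close>

type_synonym ('v, 'k) mpoly = "('v \<Rightarrow>\<^sub>0 nat) \<Rightarrow>\<^sub>0 'k"

definition Var :: "'v \<Rightarrow> ('v, 'k::field) mpoly" where
  "Var v = Poly_Mapping.single (Poly_Mapping.single v 1) 1"

definition monom_deg :: "('v::finite \<Rightarrow>\<^sub>0 nat) \<Rightarrow> nat" where
  "monom_deg t = (\<Sum>v\<in>UNIV. Poly_Mapping.lookup t v)"

text \<open>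
  The standard grading of the polynomial ring; the components of negative degree are zero.
\<close>

definition homogeneous_part :: "int \<Rightarrow> ('v::finite, 'k::field) mpoly set" where
  "homogeneous_part d = {p. \<forall>t\<in>Poly_Mapping.keys p. int (monom_deg t) = d}"

definition irrelevant_ideal :: "('v::finite, 'k::field) mpoly set" where
  "irrelevant_ideal = Idl\<^bsub>class_ring\<^esub> (range Var)"

definition edge_ideal :: "'v::finite set set \<Rightarrow> ('v, 'k::field) mpoly set" where
  "edge_ideal E = Idl\<^bsub>class_ring\<^esub> {Var u * Var v | u v. {u, v} \<in> E}"

text \<open>The quotient ring \<open>R Quot I\<close>, regarded as an \<open>R\<close>-module.\<close>

definition quotient_module :: "('a, 'c) ring_scheme \<Rightarrow> 'a set \<Rightarrow> ('a, 'a set) module" where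
  "quotient_module R I =
     \<lparr> carrier = carrier (R Quot I), mult = mult (R Quot I), one = one (R Quot I),
       zero = zero (R Quot I), add = add (R Quot I),
       smult = (\<lambda>a C. (I +>\<^bsub>R\<^esub> a) \<otimes>\<^bsub>R Quot I\<^esub> C) \<rparr>"

definition quotient_grading ::
    "('v::finite, 'k::field) mpoly set \<Rightarrow> int \<Rightarrow> ('v, 'k) mpoly set set" where
  "quotient_grading I d = (\<lambda>p. I +>\<^bsub>class_ring\<^esub> p) ` homogeneous_part d"

section \<open>Minimal graded free resolutions and projective dimension\<close>

text \<open>
  The degree \<open>d\<close> component of the graded free module \<open>\<Oplus>\<^sub>j S(- a j)\<close> of rank \<open>n\<close>, whose
  \<open>j\<close>-th basis vector has degree \<open>a j\<close>.
\<close>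

definition free_grading ::
    "nat \<Rightarrow> (nat \<Rightarrow> int) \<Rightarrow> int \<Rightarrow> ('v::finite, 'k::field) mpoly vec set" where
  "free_grading n a d = {v \<in> carrier_vec n. \<forall>j<n. v $ j \<in> homogeneous_part (d - a j)}"

text \<open>
  \<open>M\<close> is a module over the polynomial ring \<open>S\<close> and \<open>G d\<close> its component of degree \<open>d\<close>. The
  resolution is \<open>\<dots> \<rightarrow> F\<^sub>2 \<rightarrow> F\<^sub>1 \<rightarrow> F\<^sub>0 \<rightarrow> M \<rightarrow> 0\<close> with \<open>F\<^sub>i = \<Oplus>\<^sub>j S(- a i j)\<close> of rank \<open>b i\<close>,
  augmentation \<open>\<epsilon>\<close> and differentials given by matrices; mind the index shift:
  \<open>D i\<close> is the map \<open>F\<^sub>i\<^sub>+\<^sub>1 \<rightarrow> F\<^sub>i\<close>. All maps are homogeneous of degree 0.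
\<close>

definition graded_free_resolution ::
    "(('v::finite, 'k::field) mpoly, 'm) module \<Rightarrow> (int \<Rightarrow> 'm set) \<Rightarrow>
     (nat \<Rightarrow> nat) \<Rightarrow> (nat \<Rightarrow> nat \<Rightarrow> int) \<Rightarrow> (nat \<Rightarrow> ('v, 'k) mpoly mat) \<Rightarrow>
     (('v, 'k) mpoly vec \<Rightarrow> 'm) \<Rightarrow> bool" where
  "graded_free_resolution M G b a D \<epsilon> \<longleftrightarrow>
     (\<forall>i. D i \<in> carrier_mat (b i) (b (Suc i))) \<and>
     \<epsilon> \<in> LinearCombinations.module_hom class_ring (module_vec TYPE(('v, 'k) mpoly) (b 0)) M \<and>
     (\<forall>i d. \<forall>v\<in>free_grading (b (Suc i)) (a (Suc i)) d. D i *\<^sub>v v \<in> free_grading (b i) (a i) d) \<and>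
     (\<forall>d. \<forall>v\<in>free_grading (b 0) (a 0) d. \<epsilon> v \<in> G d) \<and>
     \<epsilon> ` carrier_vec (b 0) = carrier M \<and>
     {v \<in> carrier_vec (b 0). \<epsilon> v = \<zero>\<^bsub>M\<^esub>} = (\<lambda>w. D 0 *\<^sub>v w) ` carrier_vec (b 1) \<and>
     (\<forall>i. mat_kernel (D i) = (\<lambda>w. D (Suc i) *\<^sub>v w) ` carrier_vec (b (Suc (Suc i))))"

text \<open>
  Minimality: the image of \<open>F\<^sub>i\<^sub>+\<^sub>1 \<rightarrow> F\<^sub>i\<close> lies in \<open>\<mm> F\<^sub>i\<close> for the ideal \<open>\<mm>\<close> generated by the
  variables. As \<open>F\<^sub>i\<close> is free, \<open>\<mm> F\<^sub>i\<close> consists of the vectors with all entries in \<open>\<mm>\<close>.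
\<close>

definition minimal_graded_free_resolution ::
    "(('v::finite, 'k::field) mpoly, 'm) module \<Rightarrow> (int \<Rightarrow> 'm set) \<Rightarrow>
     (nat \<Rightarrow> nat) \<Rightarrow> (nat \<Rightarrow> nat \<Rightarrow> int) \<Rightarrow> (nat \<Rightarrow> ('v, 'k) mpoly mat) \<Rightarrow>
     (('v, 'k) mpoly vec \<Rightarrow> 'm) \<Rightarrow> bool" where
  "minimal_graded_free_resolution M G b a D \<epsilon> \<longleftrightarrow>
     graded_free_resolution M G b a D \<epsilon> \<and>
     (\<forall>i. \<forall>w\<in>carrier_vec (b (Suc i)). \<forall>j<b i. (D i *\<^sub>v w) $ j \<in> irrelevant_ideal)"

definition resolution_length :: "(nat \<Rightarrow> nat) \<Rightarrow> nat \<Rightarrow> bool" where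
  "resolution_length b p \<longleftrightarrow> b p \<noteq> 0 \<and> (\<forall>i>p. b i = 0)"

text \<open>
  The length of the minimal graded free resolution. For a finitely generated nonzero graded
  module it exists by the Hilbert syzygy theorem and is independent of the chosen resolution,
  the latter being unique up to isomorphism. The value for the zero module is unspecified.
\<close>

definition proj_dim ::
    "(('v::finite, 'k::field) mpoly, 'm) module \<Rightarrow> (int \<Rightarrow> 'm set) \<Rightarrow> nat" where
  "proj_dim M G =
     (THE p. \<exists>b a D \<epsilon>. minimal_graded_free_resolution M G b a D \<epsilon> \<and> resolution_length b p)"

definition proj_dim_quotient :: "('v::finite, 'k::field) mpoly set \<Rightarrow> nat" where
  "proj_dim_quotient I = proj_dim (quotient_module class_ring I) (quotient_grading I)"

end

theory Submission
  imports Defs "Jordan_Normal_Form.Determinant" "HOL-Library.Transitive_Closure_Table"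
begin

text \<open>The edge ideal of a forest can be resolved by taking away one leaf edge at a time. Let \<open>x\<close> be a leaf
with neighbour \<open>y\<close>, and let \<open>J\<close> be the ideal of the edges other than \<open>xy\<close>. As \<open>x\<close> does not occur in \<open>J\<close>, the
colon ideals \<open>J : xy\<close> and \<open>J : y\<close> agree; they are generated by the other neighbours of \<open>y\<close> and by the
edges that avoid \<open>y\<close> and all these neighbours. Multiplication by \<open>y\<close> lifts to a chain map \<open>f\<close> from a
resolution of \<open>S/(J : y)\<close> to one of \<open>S/J\<close>, and the mapping cone of \<open>x f\<close> resolves \<open>S/(J + (xy))\<close>. It is
minimal because every entry of \<open>x f\<close> is a multiple of \<open>x\<close>. So no cancellation can occur, and the projective
dimension of \<open>S/(J + (xy))\<close> is the maximum of that of \<open>S/J\<close> and one plus that of \<open>S/(J : y)\<close>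
(lemmas \<open>ideal_resolution_cone\<close> and \<open>resolvable_leaf_edge\<close>). A variable that occurs in no generator is added in
the same way and raises the projective dimension by one.

The largest number of vertices that an independent set of vertices can dominate (have as neighbours)
satisfies the same recursion (lemma \<open>dominated_max_leaf_edge\<close>), hence equals the projective dimension for
every forest (lemma \<open>forest_resolvable\<close>). That any other minimal resolution has the same length is the usual comparison
argument: two chain maps between resolutions compose to a map homotopic to the identity, and modulo the
variables the homotopy disappears when the differentials are minimal (lemma \<open>betti_le\<close>).

In the perfect binary tree of height \<open>h\<close> the vertices of the levels \<open>h - 1\<close>, \<open>h - 4\<close>, \<open>h - 7\<close>, and so on,
form an independent set that dominates all other vertices, except for the root when \<open>3\<close> divides \<open>h\<close>. No
independent set does better: each of these vertices \<open>y\<close> has a child \<open>c\<close>, every independent set leaves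
some vertex of the closed neighbourhood of \<open>c\<close> undominated, and these closed neighbourhoods, together with
that of the root when \<open>3\<close> divides \<open>h\<close>, are pairwise disjoint. Counting the levels as geometric sums gives the formulas.\<close>

section \<open>Monomials and homogeneous components\<close>

lemma monom_deg_add: "monom_deg (s + t) = monom_deg s + monom_deg t"
  by (simp add: monom_deg_def lookup_add sum.distrib)

lemma exponent_add_eq_zero_iff:
  fixes s t :: "'v \<Rightarrow>\<^sub>0 nat"
  shows "s + t = 0 \<longleftrightarrow> s = 0 \<and> t = 0"
  by (auto simp: poly_mapping_eq_iff lookup_add fun_eq_iff)

lemma homogeneous_part_zero [simp]: "0 \<in> homogeneous_part d"
  by (simp add: homogeneous_part_def)

lemma homogeneous_part_add:
  "p \<in> homogeneous_part d \<Longrightarrow> q \<in> homogeneous_part d \<Longrightarrow> p + q \<in> homogeneous_part d"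
  using keys_add[of p q] by (auto simp: homogeneous_part_def)

lemma homogeneous_part_uminus:
  "p \<in> homogeneous_part d \<Longrightarrow> - p \<in> homogeneous_part d"
  by (auto simp: homogeneous_part_def in_keys_iff)

lemma homogeneous_part_sum:
  "(\<And>i. i \<in> A \<Longrightarrow> f i \<in> homogeneous_part d) \<Longrightarrow> sum f A \<in> homogeneous_part d"
  by (induction A rule: infinite_finite_induct) (auto intro: homogeneous_part_add)

lemma homogeneous_part_mult:
  assumes "p \<in> homogeneous_part d" "q \<in> homogeneous_part e"
  shows "p * q \<in> homogeneous_part (d + e)"
  unfolding homogeneous_part_def
proof (intro CollectI ballI)
  fix t assume "t \<in> Poly_Mapping.keys (p * q)"
  then obtain a b where "t = a + b" "a \<in> Poly_Mapping.keys p" "b \<in> Poly_Mapping.keys q"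
    using keys_mult[of p q] by blast
  with assms show "int (monom_deg t) = d + e"
    by (auto simp: homogeneous_part_def monom_deg_add)
qed

lemma monomial_homogeneous: "Poly_Mapping.single s c \<in> homogeneous_part (int (monom_deg s))"
  by (simp add: homogeneous_part_def)

definition hom_component :: "int \<Rightarrow> ('v::finite, 'k::field) mpoly \<Rightarrow> ('v, 'k) mpoly" where
  "hom_component d p = Poly_Mapping.mapp (\<lambda>t c. if int (monom_deg t) = d then c else 0) p"

lemma lookup_hom_component:
  "Poly_Mapping.lookup (hom_component d p) t = (if int (monom_deg t) = d then Poly_Mapping.lookup p t else 0)"
  by (auto simp: hom_component_def lookup_mapp when_def in_keys_iff)

lemma hom_component_homogeneous: "hom_component d p \<in> homogeneous_part d"
  by (auto simp: homogeneous_part_def in_keys_iff lookup_hom_component split: if_splits)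

lemma hom_component_self: "p \<in> homogeneous_part d \<Longrightarrow> hom_component d p = p"
  by (rule poly_mapping_eqI) (auto simp: lookup_hom_component homogeneous_part_def in_keys_iff)

lemma hom_component_add: "hom_component d (p + q) = hom_component d p + hom_component d q"
  by (rule poly_mapping_eqI) (simp add: lookup_hom_component lookup_add)

lemma hom_component_sum: "hom_component d (sum f A) = (\<Sum>i\<in>A. hom_component d (f i))"
  by (rule poly_mapping_eqI) (simp add: lookup_hom_component lookup_sum)

text \<open>The terms of \<open>q\<close> outside degree \<open>e - d\<close> only contribute terms outside degree \<open>e\<close> to the product. This makes it
possible to replace a solution of a homogeneous linear system by a homogeneous one.\<close>

lemma hom_component_mult:
  assumes p: "p \<in> homogeneous_part d"
  shows "hom_component e (p * q) = p * hom_component (e - d) q"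
proof -
  let ?q = "hom_component (e - d) q"
  have "hom_component e (p * (q - ?q)) = 0"
  proof (rule poly_mapping_eqI)
    fix t
    have "int (monom_deg t) \<noteq> e" if t: "t \<in> Poly_Mapping.keys (p * (q - ?q))"
    proof -
      obtain a b where ab: "t = a + b" "a \<in> Poly_Mapping.keys p" "b \<in> Poly_Mapping.keys (q - ?q)"
        using keys_mult t by blast
      then have "int (monom_deg a) = d" "int (monom_deg b) \<noteq> e - d"
        using p by (auto simp: homogeneous_part_def in_keys_iff lookup_minus lookup_hom_component
            split: if_splits)
      then show ?thesis using ab by (simp add: monom_deg_add)
    qed
    then show "Poly_Mapping.lookup (hom_component e (p * (q - ?q))) t = Poly_Mapping.lookup 0 t"
      by (auto simp: lookup_hom_component in_keys_iff)
  qed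
  moreover have "p * ?q \<in> homogeneous_part e"
    using homogeneous_part_mult[OF p hom_component_homogeneous[of "e - d" q]] by simp
  moreover have "p * q = p * ?q + p * (q - ?q)" by (simp add: algebra_simps)
  ultimately show ?thesis
    by (simp add: hom_component_add hom_component_self)
qed

section \<open>Monomial ideals\<close>

lemma constant_coeff_mult:
  fixes p q :: "('v \<Rightarrow>\<^sub>0 nat) \<Rightarrow>\<^sub>0 'k::field"
  shows "Poly_Mapping.lookup (p * q) 0 = Poly_Mapping.lookup p 0 * Poly_Mapping.lookup q 0"
proof -
  have "(\<Sum>r. Poly_Mapping.lookup q r when 0 = l + r) = (Poly_Mapping.lookup q 0 when l = 0)" for l
  proof -
    have "(Poly_Mapping.lookup q r when 0 = l + r) = ((Poly_Mapping.lookup q 0 when l = 0) when r = 0)" for r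
      using exponent_add_eq_zero_iff[of l r] by (auto simp: when_def)
    then show ?thesis by simp
  qed
  moreover have "Poly_Mapping.lookup p l * (Poly_Mapping.lookup q 0 when l = 0) = (Poly_Mapping.lookup p 0 * Poly_Mapping.lookup q 0 when l = 0)" for l
    by (auto simp: when_def)
  ultimately show ?thesis by (simp add: lookup_mult)
qed

lemma lookup_monomial_mult:
  fixes p :: "('v \<Rightarrow>\<^sub>0 nat) \<Rightarrow>\<^sub>0 'k::field"
  shows "Poly_Mapping.lookup (Poly_Mapping.single s 1 * p) (s + t) = Poly_Mapping.lookup p t"
proof -
  have "(\<Sum>r. Poly_Mapping.lookup p r when s + t = s + r) = Poly_Mapping.lookup p t"
  proof -
    have "(Poly_Mapping.lookup p r when s + t = s + r) = (Poly_Mapping.lookup p t when r = t)" for r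
      by (auto simp: when_def)
    then show ?thesis by simp
  qed
  moreover have "Poly_Mapping.lookup (Poly_Mapping.single s 1) l * (\<Sum>r. Poly_Mapping.lookup p r when s + t = l + r) =
      ((\<Sum>r. Poly_Mapping.lookup p r when s + t = s + r) when l = s)" for l
    by (auto simp: when_def lookup_single)
  ultimately show ?thesis by (simp add: lookup_mult)
qed

text \<open>For an upward closed set \<open>U\<close> of exponents this is the ideal that the corresponding monomials generate. Edge ideals
and their colon ideals by monomials have this form, so that computing with them reduces to statements about \<open>U\<close>.\<close>

definition monomial_ideal :: "('v \<Rightarrow>\<^sub>0 nat) set \<Rightarrow> ('v, 'k::field) mpoly set" where
  "monomial_ideal U = {p. Poly_Mapping.keys p \<subseteq> U}"

definition upward_closed :: "('v \<Rightarrow>\<^sub>0 nat) set \<Rightarrow> bool" where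
  "upward_closed U \<longleftrightarrow> (\<forall>t\<in>U. \<forall>s. s + t \<in> U)"

lemma monomial_ideal_add:
  "p \<in> monomial_ideal U \<Longrightarrow> q \<in> monomial_ideal U \<Longrightarrow> p + q \<in> monomial_ideal U"
  using keys_add[of p q] by (auto simp: monomial_ideal_def)

lemma monomial_ideal_uminus: "p \<in> monomial_ideal U \<Longrightarrow> - p \<in> monomial_ideal U"
  by (auto simp: monomial_ideal_def in_keys_iff)

lemma monomial_ideal_mult:
  assumes "upward_closed U" "q \<in> monomial_ideal U"
  shows "p * q \<in> monomial_ideal U"
  using assms keys_mult[of p q] unfolding monomial_ideal_def upward_closed_def by blast

lemma ideal_monomial_ideal:
  assumes "upward_closed U"
  shows "ideal (monomial_ideal U :: ('v, 'k::field) mpoly set) class_ring"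
proof (rule idealI)
  show "ring (class_ring :: ('v, 'k) mpoly ring)" by (rule class_ring.ring_axioms)
  show "subgroup (monomial_ideal U) (add_monoid (class_ring :: ('v, 'k) mpoly ring))"
  proof (rule group.subgroupI)
    show "Group.group (add_monoid (class_ring :: ('v, 'k) mpoly ring))"
      by (rule abelian_group.a_group[OF class_ring.abelian_group_axioms])
    show "monomial_ideal U \<noteq> ({} :: ('v, 'k) mpoly set)"
      unfolding monomial_ideal_def by (metis (mono_tags) empty_iff empty_subsetI keys_zero mem_Collect_eq)
    show "inv\<^bsub>add_monoid class_ring\<^esub> p \<in> monomial_ideal U" if "p \<in> monomial_ideal U"
      for p :: "('v, 'k) mpoly"
    proof -
      have "inv\<^bsub>add_monoid class_ring\<^esub> p = - p"
        using class_ring_simps(8)[where 'a="('v, 'k) mpoly"] by (metis a_inv_def)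
      then show ?thesis using monomial_ideal_uminus that by metis
    qed
  qed (auto intro: monomial_ideal_add)
next
  fix p q :: "('v, 'k) mpoly" assume "p \<in> monomial_ideal U"
  then have "q * p \<in> monomial_ideal U" by (rule monomial_ideal_mult[OF assms])
  then show "q \<otimes>\<^bsub>class_ring\<^esub> p \<in> monomial_ideal U" "p \<otimes>\<^bsub>class_ring\<^esub> q \<in> monomial_ideal U"
    by (simp_all add: mult.commute)
qed

lemma ideal_closed_sum:
  assumes "ideal J (class_ring :: 'a::comm_ring_1 ring)" "\<And>i. i \<in> A \<Longrightarrow> f i \<in> J"
  shows "sum f A \<in> J"
  using assms(2)
proof (induction A rule: infinite_finite_induct)
  case (insert x F)
  interpret ideal J "class_ring :: 'a ring" by fact
  show ?case using insert a_closed[of "f x" "sum f F"] by simp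
qed (use ideal.axioms(1)[OF assms(1)] additive_subgroup.zero_closed in \<open>force+\<close>)

lemma sum_of_monomials:
  "(\<Sum>t\<in>Poly_Mapping.keys p. Poly_Mapping.single t (Poly_Mapping.lookup p t)) = p"
  by (rule poly_mapping_eqI) (auto simp: lookup_sum lookup_single when_def in_keys_iff sum.delta)

lemma Idl_monomials:
  "Idl\<^bsub>class_ring\<^esub> ((\<lambda>s. Poly_Mapping.single s 1) ` M) =
     (monomial_ideal {s + t | s t. s \<in> M} :: ('v, 'k::field) mpoly set)"
  (is "Idl\<^bsub>class_ring\<^esub> ?G = ?J")
proof
  have "upward_closed {s + t | s t. s \<in> M}"
    by (auto simp: upward_closed_def) (metis add.left_commute)
  then have "ideal ?J class_ring" by (rule ideal_monomial_ideal)
  moreover have "?G \<subseteq> ?J"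
    by (force simp: monomial_ideal_def intro: exI[of _ 0])
  ultimately show "Idl\<^bsub>class_ring\<^esub> ?G \<subseteq> ?J"
    by (auto simp: genideal_def)
next
  have "p \<in> J" if p: "p \<in> ?J" and J: "ideal J class_ring" "?G \<subseteq> J" for p J
  proof -
    have "Poly_Mapping.single t (Poly_Mapping.lookup p t) \<in> J" if "t \<in> Poly_Mapping.keys p" for t
    proof -
      from p that obtain s u where su: "t = s + u" "s \<in> M" by (auto simp: monomial_ideal_def)
      then have "Poly_Mapping.single u (Poly_Mapping.lookup p t) * Poly_Mapping.single s 1 \<in> J"
        using ideal.I_l_closed[OF J(1)] J(2) by (auto simp: image_subset_iff)
      then show ?thesis by (simp add: mult_single su add.commute)
    qed
    then have "(\<Sum>t\<in>Poly_Mapping.keys p. Poly_Mapping.single t (Poly_Mapping.lookup p t)) \<in> J"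
      by (rule ideal_closed_sum[OF J(1)])
    then show ?thesis by (simp add: sum_of_monomials)
  qed
  then show "?J \<subseteq> Idl\<^bsub>class_ring\<^esub> ?G"
    by (auto simp: genideal_def)
qed

text \<open>Minimality of a resolution thereby becomes a condition on the constant coefficients of the matrix
entries, and taking constant coefficients is a ring homomorphism.\<close>

lemma irrelevant_ideal_iff:
  "(p :: ('v::finite, 'k::field) mpoly) \<in> irrelevant_ideal \<longleftrightarrow> Poly_Mapping.lookup p 0 = 0"
proof -
  have "range (Var :: 'v \<Rightarrow> ('v, 'k) mpoly) =
      (\<lambda>s. Poly_Mapping.single s 1) ` range (\<lambda>v. Poly_Mapping.single v 1)"
    by (auto simp: Var_def)
  moreover have "{s + t | s t. s \<in> range (\<lambda>v::'v. Poly_Mapping.single v (1::nat))} = - {0}"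
  proof (intro equalityI subsetI)
    fix u :: "'v \<Rightarrow>\<^sub>0 nat" assume "u \<in> - {0}"
    then obtain v where "Poly_Mapping.lookup u v \<noteq> 0" by (metis ComplD insertI1 lookup_zero poly_mapping_eqI)
    then have "u = Poly_Mapping.single v 1 + (u - Poly_Mapping.single v 1)"
      by (intro poly_mapping_eqI) (auto simp: lookup_add lookup_minus lookup_single when_def)
    then show "u \<in> {s + t | s t. s \<in> range (\<lambda>v::'v. Poly_Mapping.single v (1::nat))}" by blast
  next
    fix u assume "u \<in> {s + t | s t. s \<in> range (\<lambda>v::'v. Poly_Mapping.single v (1::nat))}"
    then obtain v t where "u = Poly_Mapping.single v 1 + t" by blast
    then have "Poly_Mapping.lookup u v \<noteq> 0" by (simp add: lookup_add)
    then show "u \<in> - {0}" by auto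
  qed
  ultimately show ?thesis
    unfolding irrelevant_ideal_def by (simp only: Idl_monomials) (auto simp: monomial_ideal_def in_keys_iff)
qed

section \<open>Lifting maps of free modules\<close>

definition mat_image :: "'a::semiring_0 mat \<Rightarrow> 'a vec set" where
  "mat_image D = (\<lambda>w. D *\<^sub>v w) ` carrier_vec (dim_col D)"

lemma mult_mat_unit_vec:
  fixes A :: "'a::comm_ring_1 mat"
  assumes "A \<in> carrier_mat n m" "j < m"
  shows "A *\<^sub>v unit_vec m j = col A j"
  using assms by (intro eq_vecI) (auto simp: scalar_prod_right_unit)

lemma col_in_mat_image:
  fixes A :: "'a::comm_ring_1 mat"
  assumes "A \<in> carrier_mat n m" "j < m"
  shows "col A j \<in> mat_image A"
  using mult_mat_unit_vec[OF assms] assms unfolding mat_image_def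
  by (metis carrier_matD(2) imageI unit_vec_carrier)

lemma mat_factor:
  assumes D: "D \<in> carrier_mat n m" and X: "X \<in> carrier_mat n k"
    and im: "\<And>j. j < k \<Longrightarrow> col X j \<in> mat_image D"
  obtains Y where "Y \<in> carrier_mat m k" "D * Y = X"
proof -
  have "\<forall>j. \<exists>w. j < k \<longrightarrow> w \<in> carrier_vec m \<and> D *\<^sub>v w = col X j"
    using im D by (force simp: mat_image_def)
  then obtain w where w: "\<And>j. j < k \<Longrightarrow> w j \<in> carrier_vec m" "\<And>j. j < k \<Longrightarrow> D *\<^sub>v w j = col X j"
    by metis
  define Y where "Y = mat m k (\<lambda>(i, j). w j $ i)"
  have Y: "Y \<in> carrier_mat m k" by (simp add: Y_def)
  have col: "col Y j = w j" if "j < k" for j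
    using w(1)[OF that] that by (intro eq_vecI) (auto simp: Y_def)
  have "D * Y = X"
  proof (rule mat_col_eqI)
    fix j assume "j < dim_col X"
    then have j: "j < k" using X by simp
    show "col (D * Y) j = col X j"
      unfolding col_mult2[OF D Y j] col[OF j] by (rule w(2)[OF j])
  qed (use D X Y in auto)
  with Y that show thesis by blast
qed

text \<open>The matrices of degree-preserving maps between graded free modules with generators in degrees \<open>c\<close> (source) and
\<open>a\<close> (target).\<close>

definition graded_mat ::
    "nat \<Rightarrow> (nat \<Rightarrow> int) \<Rightarrow> nat \<Rightarrow> (nat \<Rightarrow> int) \<Rightarrow> ('v::finite, 'k::field) mpoly mat \<Rightarrow> bool" where
  "graded_mat n a m c A \<longleftrightarrow>
     A \<in> carrier_mat n m \<and> (\<forall>i<n. \<forall>j<m. A $$ (i, j) \<in> homogeneous_part (c j - a i))"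

lemma graded_mat_free_grading:
  assumes A: "graded_mat n a m c A" and v: "v \<in> free_grading m c d"
  shows "A *\<^sub>v v \<in> free_grading n a d"
proof -
  have "(\<Sum>k<m. A $$ (i, k) * v $ k) \<in> homogeneous_part (d - a i)" if i: "i < n" for i
  proof (rule homogeneous_part_sum)
    fix k assume "k \<in> {..<m}"
    then have "A $$ (i, k) * v $ k \<in> homogeneous_part ((c k - a i) + (d - c k))"
      using A v i by (intro homogeneous_part_mult) (auto simp: graded_mat_def free_grading_def)
    then show "A $$ (i, k) * v $ k \<in> homogeneous_part (d - a i)" by simp
  qed
  then show ?thesis
    using A v by (auto simp: graded_mat_def free_grading_def scalar_prod_def atLeast0LessThan)
qed

lemma mult_mat_entry:
  assumes "A \<in> carrier_mat n m" "B \<in> carrier_mat m k" "i < n" "j < k"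
  shows "(A * B) $$ (i, j) = (\<Sum>l<m. A $$ (i, l) * B $$ (l, j))"
  using assms by (auto simp: scalar_prod_def atLeast0LessThan intro!: sum.cong)

lemma graded_mat_mult:
  assumes "graded_mat n a m c A" "graded_mat m c k e B"
  shows "graded_mat n a k e (A * B)"
proof -
  have "(\<Sum>l<m. A $$ (i, l) * B $$ (l, j)) \<in> homogeneous_part (e j - a i)" if "i < n" "j < k" for i j
  proof (rule homogeneous_part_sum)
    fix l assume "l \<in> {..<m}"
    then have "A $$ (i, l) * B $$ (l, j) \<in> homogeneous_part ((c l - a i) + (e j - c l))"
      using assms that by (intro homogeneous_part_mult) (auto simp: graded_mat_def)
    then show "A $$ (i, l) * B $$ (l, j) \<in> homogeneous_part (e j - a i)" by simp
  qed
  then show ?thesis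
    using assms mult_mat_entry[of A n m B k] by (auto simp: graded_mat_def)
qed

text \<open>Any factor \<open>Y\<close> can be made homogeneous by keeping in each entry the component of the degree that
the grading prescribes, because \<open>D\<close> and \<open>X\<close> are homogeneous already.\<close>

lemma graded_mat_factor:
  assumes D: "graded_mat n a m c D" and X: "graded_mat n a k e X"
    and im: "\<And>j. j < k \<Longrightarrow> col X j \<in> mat_image D"
  obtains Y where "graded_mat m c k e Y" "D * Y = X"
proof -
  have D': "D \<in> carrier_mat n m" and X': "X \<in> carrier_mat n k"
    using D X by (auto simp: graded_mat_def)
  obtain Y where Y: "Y \<in> carrier_mat m k" "D * Y = X" by (rule mat_factor[OF D' X' im])
  define Z where "Z = mat m k (\<lambda>(i, j). hom_component (e j - c i) (Y $$ (i, j)))"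
  have Z: "graded_mat m c k e Z"
    by (auto simp: graded_mat_def Z_def hom_component_homogeneous)
  then have Z': "Z \<in> carrier_mat m k" by (simp add: graded_mat_def)
  have "D * Z = X"
  proof (rule eq_matI)
    fix i j assume "i < dim_row X" "j < dim_col X"
    then have ij: "i < n" "j < k" using X' by auto
    have "(D * Z) $$ (i, j) = (\<Sum>l<m. D $$ (i, l) * hom_component (e j - c l) (Y $$ (l, j)))"
      unfolding mult_mat_entry[OF D' Z' ij] using ij by (intro sum.cong) (auto simp: Z_def)
    also have "\<dots> = (\<Sum>l<m. hom_component (e j - a i) (D $$ (i, l) * Y $$ (l, j)))"
    proof (rule sum.cong)
      fix l assume "l \<in> {..<m}"
      then have "D $$ (i, l) \<in> homogeneous_part (c l - a i)" using D ij by (auto simp: graded_mat_def)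
      from hom_component_mult[OF this, of "e j - a i"]
      show "D $$ (i, l) * hom_component (e j - c l) (Y $$ (l, j)) =
          hom_component (e j - a i) (D $$ (i, l) * Y $$ (l, j))" by simp
    qed simp
    also have "\<dots> = hom_component (e j - a i) ((D * Y) $$ (i, j))"
      unfolding mult_mat_entry[OF D' Y(1) ij] hom_component_sum ..
    also have "\<dots> = X $$ (i, j)"
      using X ij Y(2) by (auto simp: graded_mat_def intro!: hom_component_self)
    finally show "(D * Z) $$ (i, j) = X $$ (i, j)" .
  qed (use D' X' Z' in auto)
  with Z that show thesis by blast
qed

text \<open>The inductive construction of a chain map into an exact complex. The predicate \<open>Q\<close> allows the same
construction to be used for arbitrary and for homogeneous matrices: only the factorisation step differs.\<close>

lemma lift_chain_map:
  assumes D: "\<And>i. D i \<in> carrier_mat (b i) (b (Suc i))"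
    and D': "\<And>i. D' i \<in> carrier_mat (b' i) (b' (Suc i))"
    and complex: "\<And>i. D i * D (Suc i) = 0\<^sub>m (b i) (b (Suc (Suc i)))"
    and exact: "\<And>i. mat_kernel (D' i) = mat_image (D' (Suc i))"
    and carrier: "\<And>i f. Q i f \<Longrightarrow> f \<in> carrier_mat (b' i) (b i)"
    and f0: "Q 0 f0" "\<And>j. j < b 1 \<Longrightarrow> col (f0 * D 0) j \<in> mat_image (D' 0)"
    and factor: "\<And>i f. Q i f \<Longrightarrow> (\<And>j. j < b (Suc i) \<Longrightarrow> col (f * D i) j \<in> mat_image (D' i)) \<Longrightarrow>
      \<exists>f'. Q (Suc i) f' \<and> D' i * f' = f * D i"
  obtains f where "f 0 = f0" "\<And>i. Q i (f i)" "\<And>i. D' i * f (Suc i) = f i * D i"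
proof -
  define P where "P i f \<longleftrightarrow> Q i f \<and> (i = 0 \<longrightarrow> f = f0) \<and>
    (\<forall>j<b (Suc i). col (f * D i) j \<in> mat_image (D' i))" for i f
  have "\<exists>f. \<forall>i. P i (f i) \<and> D' i * f (Suc i) = f i * D i"
  proof (rule dependent_nat_choice)
    show "\<exists>f. P 0 f" using f0 by (auto simp: P_def)
    fix f i assume "P i f"
    then have f: "Q i f" and im: "\<And>j. j < b (Suc i) \<Longrightarrow> col (f * D i) j \<in> mat_image (D' i)"
      by (simp_all add: P_def)
    obtain f' where f': "Q (Suc i) f'" "D' i * f' = f * D i" using factor[OF f im] by blast
    note c = carrier[OF f] carrier[OF f'(1)] D[of i] D[of "Suc i"] D'[of i]
    have "D' i * (f' * D (Suc i)) = D' i * f' * D (Suc i)"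
      using c by (intro assoc_mult_mat[symmetric])
    also have "\<dots> = f * (D i * D (Suc i))"
      unfolding f'(2) using c by (intro assoc_mult_mat)
    finally have "D' i * (f' * D (Suc i)) = f * (D i * D (Suc i))" .
    then have z: "D' i * (f' * D (Suc i)) = 0\<^sub>m (b' i) (b (Suc (Suc i)))"
      using c by (simp add: complex)
    have "col (f' * D (Suc i)) j \<in> mat_image (D' (Suc i))" if j: "j < b (Suc (Suc i))" for j
    proof -
      have fD: "f' * D (Suc i) \<in> carrier_mat (b' (Suc i)) (b (Suc (Suc i)))" using c by auto
      have "D' i *\<^sub>v col (f' * D (Suc i)) j = col (D' i * (f' * D (Suc i))) j"
        using col_mult2[OF D' fD j] ..
      also have "\<dots> = 0\<^sub>v (b' i)" unfolding z using j by simp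
      finally have "col (f' * D (Suc i)) j \<in> mat_kernel (D' i)"
        using fD D' j by (intro mat_kernelI[OF D']) auto
      then show ?thesis by (simp add: exact)
    qed
    with f' show "\<exists>f'. P (Suc i) f' \<and> D' i * f' = f * D i" by (auto simp: P_def)
  qed
  then obtain f where "\<And>i. P i (f i)" "\<And>i. D' i * f (Suc i) = f i * D i" by blast
  then show thesis by (intro that[of f]) (auto simp: P_def)
qed

section \<open>Uniqueness of Betti numbers\<close>

text \<open>Padded with zeros to square matrices, \<open>A\<close> and \<open>B\<close> would still be inverse to each other on the left, hence on
the right, but for \<open>m < n\<close> the padded \<open>B\<close> has a zero row.\<close>

lemma mult_eq_one_mat_imp_le:
  fixes A B :: "'a::field mat"
  assumes A: "A \<in> carrier_mat n m" and B: "B \<in> carrier_mat m n" and AB: "A * B = 1\<^sub>m n"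
  shows "n \<le> m"
proof (rule ccontr)
  assume "\<not> n \<le> m"
  then have mn: "m < n" by simp
  define A' where "A' = four_block_mat A (0\<^sub>m n (n - m)) (0\<^sub>m 0 m) (0\<^sub>m 0 (n - m))"
  define B' where "B' = four_block_mat B (0\<^sub>m m 0) (0\<^sub>m (n - m) n) (0\<^sub>m (n - m) 0)"
  have A': "A' \<in> carrier_mat n n" and B': "B' \<in> carrier_mat n n"
    using mn four_block_carrier_mat[OF A, of "0\<^sub>m 0 (n - m)" 0 "n - m"]
      four_block_carrier_mat[OF B, of "0\<^sub>m (n - m) 0" "n - m" 0]
    by (auto simp: A'_def B'_def)
  have "A' * B' = four_block_mat (A * B + 0\<^sub>m n (n - m) * 0\<^sub>m (n - m) n)
     (A * 0\<^sub>m m 0 + 0\<^sub>m n (n - m) * 0\<^sub>m (n - m) 0)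
     (0\<^sub>m 0 m * B + 0\<^sub>m 0 (n - m) * 0\<^sub>m (n - m) n)
     (0\<^sub>m 0 m * 0\<^sub>m m 0 + 0\<^sub>m 0 (n - m) * 0\<^sub>m (n - m) 0)"
    unfolding A'_def B'_def by (rule mult_four_block_mat) (use A B in auto)
  also have "\<dots> = 1\<^sub>m n" using A B AB by (intro eq_matI) auto
  finally have "B' * A' = 1\<^sub>m n" by (rule mat_mult_left_right_inverse[OF A' B'])
  moreover have "(B' * A') $$ (m, m) = 0"
  proof -
    have "row B' m = 0\<^sub>v n"
      using mn A B by (intro eq_vecI) (auto simp: B'_def)
    then show ?thesis using mn A' B' by auto
  qed
  ultimately show False using mn by simp
qed

abbreviation constant_coeff :: "('v, 'k::field) mpoly \<Rightarrow> 'k" where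
  "constant_coeff p \<equiv> Poly_Mapping.lookup p 0"

interpretation constant_coeff: comm_ring_hom "constant_coeff :: ('v, 'k::field) mpoly \<Rightarrow> 'k"
  by unfold_locales (auto simp: lookup_add constant_coeff_mult)

lemma minimal_iff_constant_coeff_zero:
  fixes A :: "('v::finite, 'k::field) mpoly mat"
  assumes A: "A \<in> carrier_mat n m"
  shows "(\<forall>w\<in>carrier_vec m. \<forall>j<n. (A *\<^sub>v w) $ j \<in> irrelevant_ideal) \<longleftrightarrow>
    map_mat constant_coeff A = 0\<^sub>m n m"
proof
  assume L: "\<forall>w\<in>carrier_vec m. \<forall>j<n. (A *\<^sub>v w) $ j \<in> irrelevant_ideal"
  show "map_mat constant_coeff A = 0\<^sub>m n m"
  proof (rule eq_matI)
    fix i j assume "i < dim_row (0\<^sub>m n m :: 'k mat)" "j < dim_col (0\<^sub>m n m :: 'k mat)"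
    then have ij: "i < n" "j < m" by auto
    have "A *\<^sub>v unit_vec m j = col A j" using A ij by (intro mult_mat_unit_vec)
    then have "A $$ (i, j) \<in> irrelevant_ideal" using L ij A by (metis index_col unit_vec_carrier carrier_matD)
    then show "map_mat constant_coeff A $$ (i, j) = 0\<^sub>m n m $$ (i, j)"
      using A ij by (simp add: irrelevant_ideal_iff)
  qed (use A in auto)
next
  assume R: "map_mat constant_coeff A = 0\<^sub>m n m"
  have "constant_coeff ((A *\<^sub>v w) $ j) = 0" if w: "w \<in> carrier_vec m" and j: "j < n" for w j
  proof -
    have "map_vec constant_coeff (A *\<^sub>v w) = 0\<^sub>v n"
      using constant_coeff.mult_mat_vec_hom[OF A w] w
      by (intro eq_vecI) (auto simp: R scalar_prod_def)
    then have "map_vec constant_coeff (A *\<^sub>v w) $ j = 0" using j by simp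
    then show ?thesis using A j by simp
  qed
  then show "\<forall>w\<in>carrier_vec m. \<forall>j<n. (A *\<^sub>v w) $ j \<in> irrelevant_ideal"
    by (simp add: irrelevant_ideal_iff)
qed

lemma module_hom_vec_add:
  "f \<in> LinearCombinations.module_hom class_ring (module_vec TYPE('a::comm_ring_1) n) M \<Longrightarrow>
    u \<in> carrier_vec n \<Longrightarrow> v \<in> carrier_vec n \<Longrightarrow> f (u + v) = f u \<oplus>\<^bsub>M\<^esub> f v"
  by (auto simp: LinearCombinations.module_hom_def module_vec_simps)

lemma module_hom_vec_smult:
  "f \<in> LinearCombinations.module_hom class_ring (module_vec TYPE('a::comm_ring_1) n) M \<Longrightarrow>
    v \<in> carrier_vec n \<Longrightarrow> f (c \<cdot>\<^sub>v v) = c \<odot>\<^bsub>M\<^esub> f v"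
  by (auto simp: LinearCombinations.module_hom_def module_vec_simps)

lemma module_hom_vec_closed:
  "f \<in> LinearCombinations.module_hom class_ring (module_vec TYPE('a::comm_ring_1) n) M \<Longrightarrow>
    v \<in> carrier_vec n \<Longrightarrow> f v \<in> carrier M"
  by (auto simp: LinearCombinations.module_hom_def module_vec_simps)

lemma module_hom_vec_zero:
  fixes f :: "'a::comm_ring_1 vec \<Rightarrow> 'm"
  assumes M: "Module.module class_ring M"
    and f: "f \<in> LinearCombinations.module_hom class_ring (module_vec TYPE('a) n) M"
  shows "f (0\<^sub>v n) = \<zero>\<^bsub>M\<^esub>"
proof -
  have z: "0 \<cdot>\<^sub>v 0\<^sub>v n = (0\<^sub>v n :: 'a vec)" by (intro eq_vecI) auto
  have "f (0 \<cdot>\<^sub>v 0\<^sub>v n) = 0 \<odot>\<^bsub>M\<^esub> f (0\<^sub>v n)" by (rule module_hom_vec_smult[OF f]) simp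
  also have "\<dots> = \<zero>\<^bsub>M\<^esub>"
    using module.smult_l_null[OF M module_hom_vec_closed[OF f zero_carrier_vec]] by simp
  finally show ?thesis by (simp add: z)
qed

text \<open>Induction on the number \<open>k\<close> of leading coordinates outside of which \<open>v\<close> vanishes.\<close>

lemma module_hom_vec_eqI:
  fixes f g :: "'a::comm_ring_1 vec \<Rightarrow> 'm"
  assumes M: "Module.module class_ring M"
    and f: "f \<in> LinearCombinations.module_hom class_ring (module_vec TYPE('a) n) M"
    and g: "g \<in> LinearCombinations.module_hom class_ring (module_vec TYPE('a) n) M"
    and unit: "\<And>j. j < n \<Longrightarrow> f (unit_vec n j) = g (unit_vec n j)"
    and v: "v \<in> carrier_vec n"
  shows "f v = g v"
proof -
  have "f v = g v" if "v \<in> carrier_vec n" "k \<le> n" "\<And>j. k \<le> j \<Longrightarrow> j < n \<Longrightarrow> v $ j = 0" for k v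
    using that
  proof (induction k arbitrary: v)
    case 0
    then have "v = 0\<^sub>v n" by (intro eq_vecI) auto
    then show ?case using module_hom_vec_zero[OF M f] module_hom_vec_zero[OF M g] by simp
  next
    case (Suc k)
    define u where "u = vec n (\<lambda>j. if j = k then 0 else v $ j)"
    have u: "u \<in> carrier_vec n" by (simp add: u_def)
    have "f u = g u"
      by (rule Suc.IH[OF u]) (use Suc.prems in \<open>auto simp: u_def\<close>)
    moreover have "v = u + v $ k \<cdot>\<^sub>v unit_vec n k"
      using Suc.prems by (intro eq_vecI) (auto simp: u_def)
    ultimately show ?case
      using module_hom_vec_add[OF f u, of "v $ k \<cdot>\<^sub>v unit_vec n k"]
        module_hom_vec_add[OF g u, of "v $ k \<cdot>\<^sub>v unit_vec n k"]
        module_hom_vec_smult[OF f unit_vec_carrier[of n k]] module_hom_vec_smult[OF g unit_vec_carrier[of n k]]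
        unit[of k] Suc.prems by simp
  qed
  from this[of v n] v show ?thesis by simp
qed

lemma mult_mat_smult_vec:
  fixes A :: "'a::comm_ring_1 mat"
  assumes "A \<in> carrier_mat n m" "v \<in> carrier_vec m"
  shows "A *\<^sub>v (c \<cdot>\<^sub>v v) = c \<cdot>\<^sub>v (A *\<^sub>v v)"
  using assms by (intro eq_vecI) (auto simp: scalar_prod_def sum_distrib_left ac_simps)

lemma module_hom_vec_mult_mat:
  fixes A :: "'a::comm_ring_1 mat"
  assumes f: "f \<in> LinearCombinations.module_hom class_ring (module_vec TYPE('a) n) M"
    and A: "A \<in> carrier_mat n m"
  shows "(\<lambda>v. f (A *\<^sub>v v)) \<in> LinearCombinations.module_hom class_ring (module_vec TYPE('a) m) M"
  using A module_hom_vec_closed[OF f] module_hom_vec_add[OF f] module_hom_vec_smult[OF f]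
  by (auto simp: LinearCombinations.module_hom_def module_vec_simps mult_add_distrib_mat_vec[OF A] mult_mat_smult_vec[OF A])

lemma graded_free_resolutionD:
  assumes "graded_free_resolution M G b a D \<epsilon>"
  shows "D i \<in> carrier_mat (b i) (b (Suc i))"
    and "\<epsilon> \<in> LinearCombinations.module_hom class_ring (module_vec TYPE(('v::finite, 'k::field) mpoly) (b 0)) M"
    and "\<epsilon> ` carrier_vec (b 0) = carrier M"
    and "{v \<in> carrier_vec (b 0). \<epsilon> v = \<zero>\<^bsub>M\<^esub>} = mat_image (D 0)"
    and "mat_kernel (D i) = mat_image (D (Suc i))"
proof -
  have D: "D i \<in> carrier_mat (b i) (b (Suc i))" for i
    using assms by (simp add: graded_free_resolution_def)
  then show "D i \<in> carrier_mat (b i) (b (Suc i))" .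
  show "\<epsilon> \<in> LinearCombinations.module_hom class_ring (module_vec TYPE(('v::finite, 'k::field) mpoly) (b 0)) M"
    "\<epsilon> ` carrier_vec (b 0) = carrier M"
    using assms by (simp_all add: graded_free_resolution_def)
  show "{v \<in> carrier_vec (b 0). \<epsilon> v = \<zero>\<^bsub>M\<^esub>} = mat_image (D 0)"
    "mat_kernel (D i) = mat_image (D (Suc i))"
    using assms carrier_matD(2)[OF D[of 0]] carrier_matD(2)[OF D[of "Suc i"]]
    by (simp_all add: graded_free_resolution_def mat_image_def)
qed

lemma mat_image_in_kernel_imp_mult_zero:
  fixes A B :: "'a::comm_ring_1 mat"
  assumes A: "A \<in> carrier_mat n m" and B: "B \<in> carrier_mat m k" and "mat_image B \<subseteq> mat_kernel A"
  shows "A * B = 0\<^sub>m n k"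
proof (rule mat_col_eqI)
  fix j assume "j < dim_col (0\<^sub>m n k :: 'a mat)"
  then have j: "j < k" by simp
  have "A *\<^sub>v col B j = 0\<^sub>v n"
    using col_in_mat_image[OF B j] assms by (auto simp: mat_kernel_def)
  then show "col (A * B) j = col (0\<^sub>m n k) j" using col_mult2[OF A B j] j by simp
qed (use A B in auto)

lemma complex_of_exact:
  fixes D :: "nat \<Rightarrow> 'a::comm_ring_1 mat"
  assumes "\<And>i. D i \<in> carrier_mat (b i) (b (Suc i))"
    and "\<And>i. mat_kernel (D i) = mat_image (D (Suc i))"
  shows "D i * D (Suc i) = 0\<^sub>m (b i) (b (Suc (Suc i)))"
  using assms by (intro mat_image_in_kernel_imp_mult_zero) auto

text \<open>The identity of \<open>M\<close> lifts to a chain map: the unit vectors of the first module are sent to preimages under the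
augmentation of the second resolution, and the rest is \<open>lift_chain_map\<close>.\<close>

lemma free_resolution_comparison:
  fixes M :: "(('v::finite, 'k::field) mpoly, 'm) module"
  assumes M: "Module.module class_ring M"
    and F: "graded_free_resolution M G b a D \<epsilon>"
    and F': "graded_free_resolution M G' b' a' D' \<epsilon>'"
  obtains (comparison) f where "\<And>i. f i \<in> carrier_mat (b' i) (b i)"
    "\<And>v. v \<in> carrier_vec (b 0) \<Longrightarrow> \<epsilon>' (f 0 *\<^sub>v v) = \<epsilon> v"
    "\<And>i. D' i * f (Suc i) = f i * D i"
proof -
  note F = graded_free_resolutionD[OF F] and F' = graded_free_resolutionD[OF F']
  have "\<forall>j. \<exists>w. w \<in> carrier_vec (b' 0) \<and> (j < b 0 \<longrightarrow> \<epsilon>' w = \<epsilon> (unit_vec (b 0) j))"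
    using F(3) F'(3) by (metis image_iff unit_vec_carrier)
  then obtain w where w: "\<And>j. w j \<in> carrier_vec (b' 0)"
    "\<And>j. j < b 0 \<Longrightarrow> \<epsilon>' (w j) = \<epsilon> (unit_vec (b 0) j)"
    by metis
  define f0 where "f0 = mat (b' 0) (b 0) (\<lambda>(i, j). w j $ i)"
  have f0: "f0 \<in> carrier_mat (b' 0) (b 0)" by (simp add: f0_def)
  have aug: "\<epsilon>' (f0 *\<^sub>v v) = \<epsilon> v" if "v \<in> carrier_vec (b 0)" for v
  proof (rule module_hom_vec_eqI[OF M module_hom_vec_mult_mat[OF F'(2) f0] F(2) _ that])
    fix j assume j: "j < b 0"
    have "f0 *\<^sub>v unit_vec (b 0) j = w j"
      using w(1)[of j] j by (intro eq_vecI) (auto simp: scalar_prod_right_unit f0_def)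
    then show "\<epsilon>' (f0 *\<^sub>v unit_vec (b 0) j) = \<epsilon> (unit_vec (b 0) j)" using w(2) j by simp
  qed
  have D0: "D 0 \<in> carrier_mat (b 0) (b 1)" using F(1)[of 0] by simp
  have cD: "D i * D (Suc i) = 0\<^sub>m (b i) (b (Suc (Suc i)))" for i
    by (rule complex_of_exact[of D b, OF F(1) F(5)])
  show thesis
  proof (rule lift_chain_map[of D b D' b' "\<lambda>i f. f \<in> carrier_mat (b' i) (b i)" f0])
    show "col (f0 * D 0) j \<in> mat_image (D' 0)" if j: "j < b 1" for j
    proof -
      have "col (D 0) j \<in> mat_image (D 0)" by (rule col_in_mat_image[OF D0 j])
      then have c: "col (D 0) j \<in> carrier_vec (b 0)" "\<epsilon> (col (D 0) j) = \<zero>\<^bsub>M\<^esub>"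
        unfolding F(4)[symmetric] by auto
      have "f0 *\<^sub>v col (D 0) j \<in> {v \<in> carrier_vec (b' 0). \<epsilon>' v = \<zero>\<^bsub>M\<^esub>}"
        using aug[OF c(1)] c f0 by auto
      then show ?thesis unfolding F'(4) using col_mult2[OF f0 D0 j] by simp
    qed
    show "\<exists>f'. f' \<in> carrier_mat (b' (Suc i)) (b (Suc i)) \<and> D' i * f' = f * D i"
      if "f \<in> carrier_mat (b' i) (b i)"
        "\<And>j. j < b (Suc i) \<Longrightarrow> col (f * D i) j \<in> mat_image (D' i)" for i f
      by (rule mat_factor[OF F'(1) mult_carrier_mat[OF that(1) F(1)] that(2)]) blast+
    show thesis if "g 0 = f0" "\<And>i. g i \<in> carrier_mat (b' i) (b i)"
      "\<And>i. D' i * g (Suc i) = g i * D i" for g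
      by (rule comparison[of g]) (use that aug in auto)
  qed (simp_all add: F(1) F'(1) F'(5) cD f0)
qed

text \<open>Let \<open>f\<close> and \<open>g\<close> be comparison maps in both directions. Then \<open>x = g f - 1\<close> lifts the zero map, so it is
null-homotopic: \<open>x i = D i h + h' D (i - 1)\<close>. Minimality of the source resolution makes both summands vanish
modulo the variables, so the constant coefficients of \<open>g i\<close> and \<open>f i\<close> have the identity matrix of size \<open>b i\<close>
as product, which bounds \<open>b i\<close> by the inner dimension \<open>b' i\<close>.\<close>

lemma betti_le:
  fixes M :: "(('v::finite, 'k::field) mpoly, 'm) module"
  assumes M: "Module.module class_ring M"
    and min: "minimal_graded_free_resolution M G b a D \<epsilon>"
    and res': "graded_free_resolution M G' b' a' D' \<epsilon>'"
  shows "b i \<le> b' i"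
proof -
  have res: "graded_free_resolution M G b a D \<epsilon>"
    using min by (simp add: minimal_graded_free_resolution_def)
  note F = graded_free_resolutionD[OF res]
  note F' = graded_free_resolutionD[OF res']
  have D_min: "map_mat constant_coeff (D i) = 0\<^sub>m (b i) (b (Suc i))" for i
    using min minimal_iff_constant_coeff_zero[OF F(1)[of i]]
    by (simp add: minimal_graded_free_resolution_def)
  obtain f where f: "\<And>i. f i \<in> carrier_mat (b' i) (b i)"
      "\<And>v. v \<in> carrier_vec (b 0) \<Longrightarrow> \<epsilon>' (f 0 *\<^sub>v v) = \<epsilon> v"
      "\<And>i. D' i * f (Suc i) = f i * D i"
    by (rule free_resolution_comparison[OF M res res'], rule that)
  obtain g where g: "\<And>i. g i \<in> carrier_mat (b i) (b' i)"
      "\<And>v. v \<in> carrier_vec (b' 0) \<Longrightarrow> \<epsilon> (g 0 *\<^sub>v v) = \<epsilon>' v"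
      "\<And>i. D i * g (Suc i) = g i * D' i"
    by (rule free_resolution_comparison[OF M res' res], rule that)
  define x where "x i = g i * f i - 1\<^sub>m (b i)" for i
  have x: "x i \<in> carrier_mat (b i) (b i)" for i
    unfolding x_def by (rule minus_carrier_mat) simp
  have x_chain: "D i * x (Suc i) = x i * D i" for i
  proof -
    note c = f(1)[of i] f(1)[of "Suc i"] g(1)[of i] g(1)[of "Suc i"] F(1)[of i] F'(1)[of i]
    have "D i * (g (Suc i) * f (Suc i)) = D i * g (Suc i) * f (Suc i)"
      using c by (intro assoc_mult_mat[symmetric])
    also have "\<dots> = g i * (D' i * f (Suc i))"
      unfolding g(3) using c by (intro assoc_mult_mat)
    also have "\<dots> = g i * f i * D i"
      unfolding f(3) using c by (intro assoc_mult_mat[symmetric])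
    finally have "D i * (g (Suc i) * f (Suc i)) = g i * f i * D i" .
    then show ?thesis
      using c mult_minus_distrib_mat[OF c(5), of "g (Suc i) * f (Suc i)" "b (Suc i)" "1\<^sub>m (b (Suc i))"]
        minus_mult_distrib_mat[of "g i * f i" "b i" "b i" "1\<^sub>m (b i)", OF _ _ c(5)]
      by (simp add: x_def)
  qed
  \<comment> \<open>\<open>N\<close> is the summand \<open>h' D (i - 1)\<close> of the homotopy formula, and zero for \<open>i = 0\<close>; only the two listed properties of it matter.\<close>
  have "\<exists>h N. h \<in> carrier_mat (b (Suc i)) (b i) \<and> N \<in> carrier_mat (b i) (b i) \<and>
      x i = D i * h + N \<and> N * D i = 0\<^sub>m (b i) (b (Suc i)) \<and>
      map_mat constant_coeff N = 0\<^sub>m (b i) (b i)" for i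
  proof (induction i)
    case 0
    have "col (x 0) j \<in> mat_image (D 0)" if j: "j < b 0" for j
    proof -
      let ?e = "unit_vec (b 0) j :: ('v, 'k) mpoly vec"
      have c: "f 0 *\<^sub>v ?e \<in> carrier_vec (b' 0)"
        by (rule mult_mat_vec_carrier[OF f(1) unit_vec_carrier])
      have gc: "g 0 *\<^sub>v (f 0 *\<^sub>v ?e) \<in> carrier_vec (b 0)"
        by (rule mult_mat_vec_carrier[OF g(1) c])
      have col: "col (x 0) j = g 0 *\<^sub>v (f 0 *\<^sub>v ?e) + (- 1) \<cdot>\<^sub>v ?e"
      proof -
        have "col (x 0) j = x 0 *\<^sub>v ?e"
          by (rule mult_mat_unit_vec[OF x j, symmetric])
        also have "\<dots> = g 0 *\<^sub>v (f 0 *\<^sub>v ?e) - ?e"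
          unfolding x_def using f(1)[of 0] g(1)[of 0] c
          by (subst minus_mult_distrib_mat_vec[of _ "b 0" "b 0"]) auto
        also have "\<dots> = g 0 *\<^sub>v (f 0 *\<^sub>v ?e) + (- 1) \<cdot>\<^sub>v ?e"
          using gc by (intro eq_vecI) auto
        finally show ?thesis .
      qed
      have e: "\<epsilon> ?e \<in> carrier M" by (rule module_hom_vec_closed[OF F(2)]) simp
      have "\<epsilon> (col (x 0) j) = \<epsilon> ?e \<oplus>\<^bsub>M\<^esub> (- 1) \<odot>\<^bsub>M\<^esub> \<epsilon> ?e"
        unfolding col using module_hom_vec_add[OF F(2) gc, of "(- 1) \<cdot>\<^sub>v ?e"]
          module_hom_vec_smult[OF F(2), of ?e "- 1"] f(2)[of ?e] g(2)[OF c] by simp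
      also have "\<dots> = 1 \<odot>\<^bsub>M\<^esub> \<epsilon> ?e \<oplus>\<^bsub>M\<^esub> (- 1) \<odot>\<^bsub>M\<^esub> \<epsilon> ?e"
        using module.smult_one[OF M e] by simp
      also have "\<dots> = (1 + (- 1)) \<odot>\<^bsub>M\<^esub> \<epsilon> ?e"
        using module.smult_l_distr[OF M _ _ e, of 1 "- 1"] by simp
      also have "\<dots> = \<zero>\<^bsub>M\<^esub>" using module.smult_l_null[OF M e] by simp
      finally show ?thesis using col_carrier_vec[OF j x[of 0]] by (subst F(4)[symmetric]) simp
    qed
    from mat_factor[OF F(1)[of 0] x[of 0] this] obtain h
      where "h \<in> carrier_mat (b 1) (b 0)" "D 0 * h = x 0" by auto
    then show ?case
      using x[of 0] F(1)[of 0]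
      by (intro exI[of _ h] exI[of _ "0\<^sub>m (b 0) (b 0)"]) auto
  next
    case (Suc i)
    then obtain h N where h: "h \<in> carrier_mat (b (Suc i)) (b i)" and N: "N \<in> carrier_mat (b i) (b i)"
      and xi: "x i = D i * h + N" and ND: "N * D i = 0\<^sub>m (b i) (b (Suc i))" by blast
    note c = F(1)[of i] F(1)[of "Suc i"] h N x[of "Suc i"]
    define y where "y = x (Suc i) - h * D i"
    have y: "y \<in> carrier_mat (b (Suc i)) (b (Suc i))" unfolding y_def using c by (intro minus_carrier_mat mult_carrier_mat)
    have "D i * y = D i * x (Suc i) - D i * (h * D i)"
      unfolding y_def using c by (intro mult_minus_distrib_mat) auto
    also have "D i * x (Suc i) = D i * (h * D i) + N * D i"
      unfolding x_chain xi using c by (simp add: add_mult_distrib_mat[of _ "b i" "b i"])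
    also have "D i * (h * D i) + N * D i - D i * (h * D i) = 0\<^sub>m (b i) (b (Suc i))"
      unfolding ND using c by (intro eq_matI) auto
    finally have Dy: "D i * y = 0\<^sub>m (b i) (b (Suc i))" .
    have "col y j \<in> mat_image (D (Suc i))" if j: "j < b (Suc i)" for j
      unfolding F(5)[symmetric] using col_mult2[OF c(1) y j] y j
      by (intro mat_kernelI[OF c(1)]) (auto simp: Dy)
    from mat_factor[OF c(2) y this] obtain h'
      where h': "h' \<in> carrier_mat (b (Suc (Suc i))) (b (Suc i))" "D (Suc i) * h' = y" by auto
    have "x (Suc i) = D (Suc i) * h' + h * D i"
      unfolding h'(2) y_def using c by (intro eq_matI) auto
    moreover have "h * D i * D (Suc i) = 0\<^sub>m (b (Suc i)) (b (Suc (Suc i)))"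
      using c complex_of_exact[of D b i, OF F(1) F(5)] by (simp add: assoc_mult_mat[OF h c(1) c(2)])
    moreover have "map_mat constant_coeff (h * D i) = 0\<^sub>m (b (Suc i)) (b (Suc i))"
      using h by (simp add: constant_coeff.mat_hom_mult[OF h c(1)] D_min)
    ultimately show ?case using h'(1) c
      by (intro exI[of _ h'] exI[of _ "h * D i"]) auto
  qed
  then obtain h N where h: "h \<in> carrier_mat (b (Suc i)) (b i)" and N: "N \<in> carrier_mat (b i) (b i)"
      and xi: "x i = D i * h + N" and N0: "map_mat constant_coeff N = 0\<^sub>m (b i) (b i)" by blast
  have "map_mat constant_coeff (D i * h) = 0\<^sub>m (b i) (b i)"
    using h by (simp add: constant_coeff.mat_hom_mult[OF F(1) h] D_min)
  moreover have "g i * f i = D i * h + N + 1\<^sub>m (b i)"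
    unfolding xi[symmetric] x_def using f(1)[of i] g(1)[of i] by (intro eq_matI) auto
  ultimately have "map_mat constant_coeff (g i * f i) = 1\<^sub>m (b i)"
    using N0 h N F(1)[of i]
    by (intro eq_matI) (auto simp: mat_eq_iff constant_coeff.hom_add)
  then show ?thesis
    using mult_eq_one_mat_imp_le[of "map_mat constant_coeff (g i)" "b i" "b' i" "map_mat constant_coeff (f i)"]
      f(1)[of i] g(1)[of i] constant_coeff.mat_hom_mult[OF g(1) f(1)] by simp
qed

lemma resolution_length_unique:
  fixes M :: "(('v::finite, 'k::field) mpoly, 'm) module"
  assumes M: "Module.module class_ring M"
    and "minimal_graded_free_resolution M G b a D \<epsilon>" "resolution_length b p"
    and "minimal_graded_free_resolution M G b' a' D' \<epsilon>'" "resolution_length b' p'"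
  shows "p = p'"
proof -
  have "b i = b' i" for i
    using assms by (intro antisym betti_le[OF M]) (auto simp: minimal_graded_free_resolution_def)
  then show ?thesis
    using assms(3,5) unfolding resolution_length_def by (metis linorder_neqE_nat)
qed

lemma proj_dim_eqI:
  fixes M :: "(('v::finite, 'k::field) mpoly, 'm) module"
  assumes "Module.module class_ring M"
    and "minimal_graded_free_resolution M G b a D \<epsilon>" "resolution_length b p"
  shows "proj_dim M G = p"
  unfolding proj_dim_def using assms resolution_length_unique by blast

section \<open>Mapping cones\<close>

text \<open>A minimal graded free resolution of \<open>S/K\<close> with first module \<open>S\<close> generated in degree zero. The augmentation is
left implicit: the image of \<open>D 0\<close> is required to be \<open>K\<close>, seen as a set of vectors of length one.\<close>

definition ideal_resolution ::
    "('v::finite, 'k::field) mpoly set \<Rightarrow> (nat \<Rightarrow> nat) \<Rightarrow> (nat \<Rightarrow> nat \<Rightarrow> int) \<Rightarrow>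
     (nat \<Rightarrow> ('v, 'k) mpoly mat) \<Rightarrow> bool" where
  "ideal_resolution K b a D \<longleftrightarrow>
     b 0 = 1 \<and> a 0 0 = 0 \<and>
     (\<forall>i. graded_mat (b i) (a i) (b (Suc i)) (a (Suc i)) (D i)) \<and>
     (\<forall>i. \<forall>j<b i. \<forall>k<b (Suc i). constant_coeff (D i $$ (j, k)) = 0) \<and>
     mat_image (D 0) = {v \<in> carrier_vec 1. v $ 0 \<in> K} \<and>
     (\<forall>i. mat_kernel (D i) = mat_image (D (Suc i)))"

lemma ideal_resolutionD:
  assumes "ideal_resolution K b a D"
  shows "b 0 = 1" "a 0 0 = 0" "graded_mat (b i) (a i) (b (Suc i)) (a (Suc i)) (D i)"
    "D i \<in> carrier_mat (b i) (b (Suc i))"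
    "j < b i \<Longrightarrow> k < b (Suc i) \<Longrightarrow> constant_coeff (D i $$ (j, k)) = 0"
    "mat_image (D 0) = {v \<in> carrier_vec 1. v $ 0 \<in> K}"
    "mat_kernel (D i) = mat_image (D (Suc i))"
  using assms by (auto simp: ideal_resolution_def graded_mat_def)

lemma mult_mat_uminus_vec:
  fixes A :: "'a::comm_ring_1 mat"
  assumes "A \<in> carrier_mat n m" "v \<in> carrier_vec m"
  shows "A *\<^sub>v (- v) = - (A *\<^sub>v v)"
  using assms by (intro eq_vecI) (auto simp: scalar_prod_def sum_negf)

lemma zero_mat_mult_vec:
  "v \<in> carrier_vec m \<Longrightarrow> 0\<^sub>m n m *\<^sub>v v = (0\<^sub>v n :: 'a::comm_ring_1 vec)"
  by (intro eq_vecI) (auto simp: scalar_prod_def)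

lemma mat_imageE:
  assumes "v \<in> mat_image A" "A \<in> carrier_mat n m"
  obtains w where "w \<in> carrier_vec m" "v = A *\<^sub>v w"
  using assms by (auto simp: mat_image_def)

lemma mat_imageI: "A \<in> carrier_mat n m \<Longrightarrow> w \<in> carrier_vec m \<Longrightarrow> A *\<^sub>v w \<in> mat_image A"
  by (auto simp: mat_image_def)

lemma split_vec:
  assumes "v \<in> carrier_vec (n + m)"
  obtains u w where "u \<in> carrier_vec n" "w \<in> carrier_vec m" "v = u @\<^sub>v w"
  using assms by (metis vec_first_carrier vec_last_carrier vec_first_last_append)

text \<open>Exactness of a mapping cone at one spot. The matrices \<open>E0\<close>, \<open>E1\<close> are differentials of the source complex with changed
sign, so that the chain map condition reads \<open>D0 X1 = - (X0 E1)\<close>. The hypothesis \<open>ker_E\<close> is exactness of the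
source complex, restricted to those \<open>w\<close> that can occur: at the start of the cone the differential \<open>E0\<close>
is an empty matrix, and the other condition, \<open>D0 u + X0 w = 0\<close>, has to do the work.\<close>

lemma mapping_cone_exact:
  fixes D0 D1 X0 X1 E0 E1 :: "'a::comm_ring_1 mat"
  assumes D0: "D0 \<in> carrier_mat n0 n1" and D1: "D1 \<in> carrier_mat n1 n2"
    and X0: "X0 \<in> carrier_mat n0 m1" and X1: "X1 \<in> carrier_mat n1 m2"
    and E0: "E0 \<in> carrier_mat m0 m1" and E1: "E1 \<in> carrier_mat m1 m2"
    and ker: "mat_kernel D0 = mat_image D1"
    and anti: "D0 * X1 = - (X0 * E1)" and EE: "E0 * E1 = 0\<^sub>m m0 m2"
    and ker_E: "\<And>u w. u \<in> carrier_vec n1 \<Longrightarrow> w \<in> carrier_vec m1 \<Longrightarrow> E0 *\<^sub>v w = 0\<^sub>v m0 \<Longrightarrow>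
      D0 *\<^sub>v u + X0 *\<^sub>v w = 0\<^sub>v n0 \<Longrightarrow> w \<in> mat_image E1"
  shows "mat_kernel (four_block_mat D0 X0 (0\<^sub>m m0 n1) E0) =
    mat_image (four_block_mat D1 X1 (0\<^sub>m m1 n2) E1)" (is "mat_kernel ?C0 = mat_image ?C1")
proof -
  have C0: "?C0 \<in> carrier_mat (n0 + m0) (n1 + m1)" and C1: "?C1 \<in> carrier_mat (n1 + m1) (n2 + m2)"
    using D0 D1 E0 E1 by auto
  have C0v: "?C0 *\<^sub>v (u @\<^sub>v w) = (D0 *\<^sub>v u + X0 *\<^sub>v w) @\<^sub>v (E0 *\<^sub>v w)"
    if "u \<in> carrier_vec n1" "w \<in> carrier_vec m1" for u w
    using four_block_mat_mult_vec[OF D0 X0 zero_carrier_mat E0 that] that E0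
    by (simp add: mult_mat_vec_carrier[OF E0] zero_mat_mult_vec)
  have C1v: "?C1 *\<^sub>v (y @\<^sub>v z) = (D1 *\<^sub>v y + X1 *\<^sub>v z) @\<^sub>v (E1 *\<^sub>v z)"
    if "y \<in> carrier_vec n2" "z \<in> carrier_vec m2" for y z
    using four_block_mat_mult_vec[OF D1 X1 zero_carrier_mat E1 that] that E1
    by (simp add: mult_mat_vec_carrier[OF E1] zero_mat_mult_vec)
  have zero_append: "0\<^sub>v (n0 + m0) = 0\<^sub>v n0 @\<^sub>v (0\<^sub>v m0 :: 'a vec)" by (intro eq_vecI) auto
  have DX: "D0 *\<^sub>v (X1 *\<^sub>v z) + X0 *\<^sub>v (E1 *\<^sub>v z) = 0\<^sub>v n0" if z: "z \<in> carrier_vec m2" for z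
  proof -
    have "D0 *\<^sub>v (X1 *\<^sub>v z) = - (X0 * E1) *\<^sub>v z"
      using assoc_mult_mat_vec[OF D0 X1 z] by (simp add: anti)
    also have "\<dots> = - (X0 *\<^sub>v (E1 *\<^sub>v z))"
      using assoc_mult_mat_vec[OF X0 E1 z] z E1 by (simp add: uminus_mult_mat_vec)
    finally show ?thesis using X0 by (intro eq_vecI) auto
  qed
  show ?thesis
  proof (intro equalityI subsetI)
    fix v assume "v \<in> mat_kernel ?C0"
    then have v: "v \<in> carrier_vec (n1 + m1)" "?C0 *\<^sub>v v = 0\<^sub>v (n0 + m0)"
      using mat_kernelD[OF C0] by auto
    obtain u w where uw: "u \<in> carrier_vec n1" "w \<in> carrier_vec m1" "v = u @\<^sub>v w"
      using split_vec[OF v(1)] .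
    have "(D0 *\<^sub>v u + X0 *\<^sub>v w) @\<^sub>v (E0 *\<^sub>v w) = 0\<^sub>v n0 @\<^sub>v 0\<^sub>v m0"
      using v(2) C0v[OF uw(1,2)] uw(3) zero_append by simp
    then have eq: "D0 *\<^sub>v u + X0 *\<^sub>v w = 0\<^sub>v n0" "E0 *\<^sub>v w = 0\<^sub>v m0"
      using append_vec_eq[of "D0 *\<^sub>v u + X0 *\<^sub>v w" n0 "0\<^sub>v n0"] D0 X0 uw by auto
    obtain z where z: "z \<in> carrier_vec m2" "w = E1 *\<^sub>v z"
      using ker_E[OF uw(1,2) eq(2,1)] mat_imageE[OF _ E1] by blast
    have Xz: "X1 *\<^sub>v z \<in> carrier_vec n1" by (rule mult_mat_vec_carrier[OF X1 z(1)])
    have "D0 *\<^sub>v (u - X1 *\<^sub>v z) = D0 *\<^sub>v u - D0 *\<^sub>v (X1 *\<^sub>v z)"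
      by (rule mult_minus_distrib_mat_vec[OF D0 uw(1) Xz])
    also have "\<dots> = 0\<^sub>v n0"
    proof (rule eq_vecI)
      fix j assume "j < dim_vec (0\<^sub>v n0 :: 'a vec)"
      then have j: "j < n0" by simp
      have "(D0 *\<^sub>v u + X0 *\<^sub>v w) $ j = 0" "(D0 *\<^sub>v (X1 *\<^sub>v z) + X0 *\<^sub>v w) $ j = 0"
        using eq(1) DX[OF z(1)] z(2) j by simp_all
      then have "(D0 *\<^sub>v u) $ j + (X0 *\<^sub>v w) $ j = 0" "(D0 *\<^sub>v (X1 *\<^sub>v z)) $ j + (X0 *\<^sub>v w) $ j = 0"
        using D0 X0 j by (simp_all del: index_mult_mat_vec)
      then have "(D0 *\<^sub>v u) $ j = (D0 *\<^sub>v (X1 *\<^sub>v z)) $ j" by (metis add_right_cancel)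
      then show "(D0 *\<^sub>v u - D0 *\<^sub>v (X1 *\<^sub>v z)) $ j = 0\<^sub>v n0 $ j"
        using D0 j by (simp del: index_mult_mat_vec)
    qed (use D0 in auto)
    finally have "u - X1 *\<^sub>v z \<in> mat_kernel D0"
      using uw(1) Xz by (intro mat_kernelI[OF D0]) auto
    then obtain y where y: "y \<in> carrier_vec n2" "u - X1 *\<^sub>v z = D1 *\<^sub>v y"
      unfolding ker by (rule mat_imageE[OF _ D1])
    have "u = D1 *\<^sub>v y + X1 *\<^sub>v z"
      unfolding y(2)[symmetric] using uw(1) Xz X1 by (intro eq_vecI) (auto simp del: index_mult_mat_vec)
    then have "v = ?C1 *\<^sub>v (y @\<^sub>v z)" using C1v[OF y(1) z(1)] uw(3) z(2) by simp
    then show "v \<in> mat_image ?C1" using y(1) z(1) mat_imageI[OF C1] by auto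
  next
    fix v assume "v \<in> mat_image ?C1"
    then obtain v' where v': "v' \<in> carrier_vec (n2 + m2)" "v = ?C1 *\<^sub>v v'" by (rule mat_imageE[OF _ C1])
    obtain y z where yz: "y \<in> carrier_vec n2" "z \<in> carrier_vec m2" "v' = y @\<^sub>v z"
      using split_vec[OF v'(1)] .
    note c = mult_mat_vec_carrier[OF D1 yz(1)] mult_mat_vec_carrier[OF X1 yz(2)]
      mult_mat_vec_carrier[OF E1 yz(2)]
    have "D0 *\<^sub>v (D1 *\<^sub>v y) = 0\<^sub>v n0"
      using mat_imageI[OF D1 yz(1)] unfolding ker[symmetric] by (rule mat_kernelD(2)[OF D0])
    then have "D0 *\<^sub>v (D1 *\<^sub>v y + X1 *\<^sub>v z) + X0 *\<^sub>v (E1 *\<^sub>v z) = 0\<^sub>v n0"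
      using DX[OF yz(2)] mult_add_distrib_mat_vec[OF D0 c(1,2)] mult_mat_vec_carrier[OF D0 c(2)] by simp
    moreover have "E0 *\<^sub>v (E1 *\<^sub>v z) = 0\<^sub>v m0"
      using assoc_mult_mat_vec[OF E0 E1 yz(2)] zero_mat_mult_vec[OF yz(2)] EE by simp
    ultimately have "?C0 *\<^sub>v v = 0\<^sub>v (n0 + m0)"
      using C0v[of "D1 *\<^sub>v y + X1 *\<^sub>v z" "E1 *\<^sub>v z"] C1v[OF yz(1,2)] c v'(2) yz(3) zero_append by simp
    then show "v \<in> mat_kernel ?C0"
      using v' by (intro mat_kernelI[OF C0]) (auto intro: mult_mat_vec_carrier[OF C1])
  qed
qed

text \<open>Let \<open>f\<close> lift the multiplication by \<open>g\<close>, which maps \<open>L\<close> into \<open>K\<close>, to the resolutions. The mapping cone of \<open>x f\<close>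
is exact in its first step because \<open>x g p\<close> lies in \<open>K\<close> only for \<open>p\<close> in \<open>L\<close>, and it is minimal because all
entries of \<open>x f\<close> are multiples of \<open>x\<close>, which has no constant term.\<close>

lemma ideal_resolution_cone:
  fixes K L :: "('v::finite, 'k::field) mpoly set"
  assumes K: "ideal_resolution K b a D" and L: "ideal_resolution L b' a' D'"
    and x: "x \<in> homogeneous_part e" "constant_coeff x = 0"
    and g: "g \<in> homogeneous_part d" "\<And>p. p \<in> L \<Longrightarrow> g * p \<in> K"
    and xg: "\<And>p. x * g * p \<in> K \<Longrightarrow> p \<in> L"
  obtains b'' a'' D'' where "ideal_resolution {p + x * g * q | p q. p \<in> K} b'' a'' D''"
    "b'' 0 = b 0" "\<And>i. b'' (Suc i) = b (Suc i) + b' i"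
proof -
  note K = ideal_resolutionD[OF K] and L = ideal_resolutionD[OF L]
  have b0: "b 0 = 1" "b' 0 = 1" using K(1) L(1) .
  have D'_image: "p \<in> L" if "j < b' 1" "p = D' 0 $$ (0, j)" for j p
  proof -
    have D'0: "D' 0 \<in> carrier_mat 1 (b' 1)" using L(4)[of 0] b0 by simp
    have "col (D' 0) j \<in> {v \<in> carrier_vec 1. v $ 0 \<in> L}"
      using col_in_mat_image[OF D'0 that(1)] unfolding L(6) .
    then show ?thesis using D'0 that by simp
  qed
  define f0 where "f0 = mat 1 1 (\<lambda>_. g)"
  have "\<exists>f. f 0 = f0 \<and> (\<forall>i. graded_mat (b i) (a i) (b' i) (\<lambda>j. a' i j + d) (f i)) \<and>
    (\<forall>i. D i * f (Suc i) = f i * D' i)" (is "?ex")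
  proof (rule lift_chain_map[of D' b' D b "\<lambda>i f. graded_mat (b i) (a i) (b' i) (\<lambda>j. a' i j + d) f" f0])
    show "graded_mat (b 0) (a 0) (b' 0) (\<lambda>j. a' 0 j + d) f0"
      using g(1) by (simp add: graded_mat_def f0_def b0 K(2) L(2))
    have f0: "f0 \<in> carrier_mat (b 0) (b' 0)" by (simp add: f0_def b0)
    show "col (f0 * D' 0) j \<in> mat_image (D 0)" if j: "j < b' 1" for j
    proof -
      have D'0: "D' 0 \<in> carrier_mat 1 (b' 1)" using L(4)[of 0] b0 by simp
      have f0: "f0 \<in> carrier_mat 1 1" by (simp add: f0_def)
      have "(f0 * D' 0) $$ (0, j) = (\<Sum>l<1. f0 $$ (0, l) * D' 0 $$ (l, j))"
        by (rule mult_mat_entry[OF f0 D'0 _ j]) simp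
      also have "\<dots> = g * D' 0 $$ (0, j)" by (simp add: f0_def)
      also have "\<dots> \<in> K" by (rule g(2)[OF D'_image[OF j refl]])
      finally have "(f0 * D' 0) $$ (0, j) \<in> K" .
      moreover have c: "f0 * D' 0 \<in> carrier_mat 1 (b' 1)" by (rule mult_carrier_mat[OF f0 D'0])
      ultimately have "col (f0 * D' 0) j $ 0 \<in> K" using j by (subst index_col) auto
      then show ?thesis unfolding K(6) using col_carrier_vec[OF j c] by blast
    qed
    show "\<exists>f'. graded_mat (b (Suc i)) (a (Suc i)) (b' (Suc i)) (\<lambda>j. a' (Suc i) j + d) f' \<and>
        D i * f' = f * D' i"
      if f: "graded_mat (b i) (a i) (b' i) (\<lambda>j. a' i j + d) f"
        and im: "\<And>j. j < b' (Suc i) \<Longrightarrow> col (f * D' i) j \<in> mat_image (D i)" for i f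
    proof -
      have "graded_mat (b' i) (\<lambda>j. a' i j + d) (b' (Suc i)) (\<lambda>j. a' (Suc i) j + d) (D' i)"
        using L(3)[of i] by (simp add: graded_mat_def)
      from graded_mat_factor[OF K(3)[of i] graded_mat_mult[OF f this] im] show ?thesis by blast
    qed
    show "D' i * D' (Suc i) = 0\<^sub>m (b' i) (b' (Suc (Suc i)))" for i
      by (rule complex_of_exact[of D' b', OF L(4) L(7)])
    show ?ex if "f 0 = f0" "\<And>i. graded_mat (b i) (a i) (b' i) (\<lambda>j. a' i j + d) (f i)"
      "\<And>i. D i * f (Suc i) = f i * D' i" for f
      using that by blast
  qed (simp_all add: K(4,7) L(4) graded_mat_def)
  then obtain f where f: "f 0 = f0" "\<And>i. graded_mat (b i) (a i) (b' i) (\<lambda>j. a' i j + d) (f i)"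
    "\<And>i. D i * f (Suc i) = f i * D' i"
    by blast
  have fc: "f i \<in> carrier_mat (b i) (b' i)" for i using f(2)[of i] by (simp add: graded_mat_def)
  define X where "X i = x \<cdot>\<^sub>m f i" for i
  have X: "X i \<in> carrier_mat (b i) (b' i)" for i using fc[of i] by (simp add: X_def)
  \<comment> \<open>The source complex shifted by one place: \<open>r\<close> its ranks, \<open>s\<close> its degrees, \<open>E\<close> its differentials. In place \<open>0\<close> it is the zero module, which makes the first differential of the cone an instance of the general block matrix.\<close>
  define r where "r i = (case i of 0 \<Rightarrow> 0 | Suc l \<Rightarrow> b' l)" for i
  define s where "s i j = (case i of 0 \<Rightarrow> 0 | Suc l \<Rightarrow> a' l j + (d + e))" for i j
  define E where "E i = (case i of 0 \<Rightarrow> 0\<^sub>m 0 (b' 0) | Suc l \<Rightarrow> - D' l)" for i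
  have r [simp]: "r 0 = 0" "r (Suc i) = b' i" for i by (simp_all add: r_def)
  have E0 [simp]: "E 0 = 0\<^sub>m 0 (b' 0)" and ES [simp]: "E (Suc i) = - D' i" for i by (simp_all add: E_def)
  have E: "E i \<in> carrier_mat (r i) (b' i)" for i
    using L(4) by (cases i) auto
  have anti: "D i * X (Suc i) = - (X i * E (Suc i))" for i
  proof -
    have "D i * X (Suc i) = x \<cdot>\<^sub>m (f i * D' i)"
      unfolding X_def f(3)[symmetric] by (rule mult_smult_distrib[OF K(4) fc])
    also have "\<dots> = X i * D' i"
      unfolding X_def by (rule mult_smult_assoc_mat[OF fc L(4), symmetric])
    also have "\<dots> = - (X i * E (Suc i))"
    proof -
      have "dim_col (X i) = dim_row (D' i)" using X[of i] L(4)[of i] by simp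
      then have "X i * E (Suc i) = - (X i * D' i)" by (simp add: uminus_mult_right_mat)
      then show ?thesis by (intro eq_matI) simp_all
    qed
    finally show ?thesis .
  qed
  have EE: "E i * E (Suc i) = 0\<^sub>m (r i) (b' (Suc i))" for i
  proof (cases i)
    case 0
    then show ?thesis using E[of 1] by (intro eq_matI) auto
  next
    case (Suc l)
    have "- D' l * - D' (Suc l) = D' l * D' (Suc l)"
    proof -
      have "dim_col (D' l) = dim_row (D' (Suc l))" using L(4)[of l] L(4)[of "Suc l"] by simp
      then have "- D' l * - D' (Suc l) = - (- (D' l * D' (Suc l)))"
        by (simp add: uminus_mult_right_mat uminus_mult_left_mat)
      then show ?thesis by (intro eq_matI) simp_all
    qed
    then show ?thesis using complex_of_exact[of D' b' l, OF L(4) L(7)] Suc by simp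
  qed
  have ker_E: "w \<in> mat_image (E (Suc i))"
    if u: "u \<in> carrier_vec (b (Suc i))" and w: "w \<in> carrier_vec (b' i)"
      and Ew: "E i *\<^sub>v w = 0\<^sub>v (r i)" and eq: "D i *\<^sub>v u + X i *\<^sub>v w = 0\<^sub>v (b i)" for i u w
  proof -
    \<comment> \<open>For \<open>i = 0\<close> the entry of \<open>w\<close> lies in \<open>L\<close> by the assumption \<open>xg\<close>; otherwise this is exactness of \<open>D'\<close>.\<close>
    have "- w \<in> mat_image (D' i)"
    proof (cases i)
      case 0
      have "(D 0 *\<^sub>v u + X 0 *\<^sub>v w) $ 0 = 0" using eq 0 b0 by simp
      moreover have "(X 0 *\<^sub>v w) $ 0 = x * g * w $ 0"
        using w 0 b0 by (simp add: X_def f f0_def scalar_prod_def)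
      ultimately have "(D 0 *\<^sub>v u) $ 0 = - (x * g * w $ 0)"
        using K(4)[of 0] X[of 0] b0 by (simp add: eq_neg_iff_add_eq_0 del: index_mult_mat_vec)
      moreover have "D 0 *\<^sub>v u \<in> mat_image (D 0)" using mat_imageI[OF K(4)[of 0]] u 0 by simp
      ultimately have "x * g * (- w $ 0) \<in> K" by (simp add: K(6))
      then have "- w $ 0 \<in> L" by (rule xg)
      then show ?thesis using w 0 b0 by (simp add: L(6))
    next
      case (Suc l)
      have "D' l *\<^sub>v w = 0\<^sub>v (b' l)"
      proof (rule eq_vecI)
        fix j assume "j < dim_vec (0\<^sub>v (b' l) :: ('v, 'k) mpoly vec)"
        then have "j < b' l" "(- D' l *\<^sub>v w) $ j = 0" using Ew Suc by simp_all
        then show "(D' l *\<^sub>v w) $ j = 0\<^sub>v (b' l) $ j"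
          using w Suc L(4)[of l] by (simp add: uminus_mult_mat_vec del: index_mult_mat_vec)
      qed (use L(4)[of l] in simp)
      then have "w \<in> mat_image (D' i)"
        using w Suc L(4)[of l] L(7)[of l] mat_kernelI[OF L(4)[of l]] by auto
      then obtain z where "z \<in> carrier_vec (b' (Suc i))" "w = D' i *\<^sub>v z" by (rule mat_imageE[OF _ L(4)])
      then show ?thesis
        using mat_imageI[OF L(4), of "- z" i] L(4)[of i] by (simp add: mult_mat_uminus_vec)
    qed
    then obtain z where z: "z \<in> carrier_vec (b' (Suc i))" "- w = D' i *\<^sub>v z" by (rule mat_imageE[OF _ L(4)])
    then have "w = - D' i *\<^sub>v z" using L(4)[of i] by (simp add: uminus_mult_mat_vec flip: z(2))
    then show ?thesis using mat_imageI[of "- D' i" "b' i" "b' (Suc i)" z] z L(4)[of i] by simp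
  qed
  define b'' where "b'' i = b i + r i" for i
  define a'' where "a'' i j = (if j < b i then a i j else s i (j - b i))" for i j
  define C where "C i = four_block_mat (D i) (X i) (0\<^sub>m (r i) (b (Suc i))) (E i)" for i
  have C: "C i \<in> carrier_mat (b'' i) (b'' (Suc i))" for i
    unfolding C_def b''_def using four_block_carrier_mat[OF K(4) E] by simp
  have entry: "C i $$ (j, k) =
      (if j < b i then if k < b (Suc i) then D i $$ (j, k) else x * f i $$ (j, k - b (Suc i))
       else if k < b (Suc i) then 0 else E i $$ (j - b i, k - b (Suc i)))"
    if "j < b'' i" "k < b'' (Suc i)" for i j k
    using that K(4)[of i] E[of i] fc[of i] by (simp add: C_def b''_def X_def)
  have "ideal_resolution {p + x * g * q | p q. p \<in> K} b'' a'' C"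
    unfolding ideal_resolution_def
  proof (intro conjI allI impI)
    show "b'' 0 = 1" "a'' 0 0 = 0" using b0 K(2) by (simp_all add: b''_def a''_def)
    show "mat_kernel (C i) = mat_image (C (Suc i))" for i
      unfolding C_def r by (rule mapping_cone_exact[OF K(4) K(4) X X E E[of "Suc i", unfolded r] K(7) anti EE ker_E])
    show "constant_coeff (C i $$ (j, k)) = 0" if jk: "j < b'' i" "k < b'' (Suc i)" for i j k
    proof -
      have "constant_coeff (E i $$ (j - b i, k - b (Suc i))) = 0" if "\<not> j < b i" "\<not> k < b (Suc i)"
      proof (cases i)
        case (Suc l)
        then show ?thesis using that jk L(4)[of l] L(5)[of "j - b i" l "k - b (Suc i)"] by (simp add: b''_def)
      qed (use jk that in \<open>simp add: b''_def\<close>)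
      then show ?thesis using entry[OF jk] K(5)[of j i k] x(2) by (simp add: constant_coeff_mult)
    qed
    show "graded_mat (b'' i) (a'' i) (b'' (Suc i)) (a'' (Suc i)) (C i)" for i
      unfolding graded_mat_def
    proof (intro conjI allI impI)
      fix j k assume jk: "j < b'' i" "k < b'' (Suc i)"
      consider "j < b i" "k < b (Suc i)" | "j < b i" "\<not> k < b (Suc i)" | "\<not> j < b i" "k < b (Suc i)"
        | "\<not> j < b i" "\<not> k < b (Suc i)" by blast
      then show "C i $$ (j, k) \<in> homogeneous_part (a'' (Suc i) k - a'' i j)"
      proof cases
        case 1
        then show ?thesis using K(3)[of i] entry[OF jk] by (simp add: graded_mat_def a''_def)
      next
        case 2
        let ?k = "k - b (Suc i)"
        have "f i $$ (j, ?k) \<in> homogeneous_part (a' i ?k + d - a i j)"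
          using f(2)[of i] 2 jk by (auto simp: graded_mat_def b''_def)
        from homogeneous_part_mult[OF x(1) this] show ?thesis
          using 2 entry[OF jk] by (simp add: a''_def s_def algebra_simps)
      next
        case 3
        then show ?thesis using entry[OF jk] by simp
      next
        case 4
        show ?thesis
        proof (cases i)
          case 0
          then show ?thesis using 4 jk by (simp add: b''_def)
        next
          case (Suc l)
          have "D' l $$ (j - b i, k - b (Suc i)) \<in> homogeneous_part (a' i (k - b (Suc i)) - a' l (j - b i))"
            using L(3)[of l] 4 jk Suc by (simp add: graded_mat_def b''_def)
          then show ?thesis
            using 4 entry[OF jk] Suc L(4)[of l] jk
            by (simp add: a''_def s_def b''_def homogeneous_part_uminus)
        qed
      qed
    qed (rule C)
    show "mat_image (C 0) = {v \<in> carrier_vec 1. v $ 0 \<in> {p + x * g * q | p q. p \<in> K}}"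
    proof -
      have C0: "(C 0 *\<^sub>v (u @\<^sub>v w)) $ 0 = (D 0 *\<^sub>v u) $ 0 + x * g * w $ 0"
        if "u \<in> carrier_vec (b 1)" "w \<in> carrier_vec 1" for u w
      proof -
        have "C 0 *\<^sub>v (u @\<^sub>v w) = (D 0 *\<^sub>v u + X 0 *\<^sub>v w) @\<^sub>v (0\<^sub>m (r 0) (b 1) *\<^sub>v u + E 0 *\<^sub>v w)"
          unfolding C_def using that b0 four_block_mat_mult_vec[OF K(4)[of 0] X[of 0] zero_carrier_mat E[of 0], of u w]
          by simp
        moreover have "(X 0 *\<^sub>v w) $ 0 = x * g * w $ 0"
          using that b0 by (simp add: X_def f f0_def scalar_prod_def)
        ultimately show ?thesis using K(4)[of 0] X[of 0] b0 by (simp del: index_mult_mat_vec)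
      qed
      have c: "C 0 \<in> carrier_mat 1 (b 1 + 1)" using C[of 0] b0 by (simp add: b''_def)
      show ?thesis
      proof (intro equalityI subsetI)
        fix v assume "v \<in> mat_image (C 0)"
        then obtain y where y: "y \<in> carrier_vec (b 1 + 1)" "v = C 0 *\<^sub>v y" by (rule mat_imageE[OF _ c])
        obtain u w where uw: "u \<in> carrier_vec (b 1)" "w \<in> carrier_vec 1" "y = u @\<^sub>v w"
          using split_vec[OF y(1)] .
        have "D 0 *\<^sub>v u \<in> mat_image (D 0)" using mat_imageI[OF K(4)[of 0]] uw by simp
        then have "(D 0 *\<^sub>v u) $ 0 \<in> K" by (simp add: K(6))
        moreover have "v \<in> carrier_vec 1" using y c by auto
        ultimately show "v \<in> {v \<in> carrier_vec 1. v $ 0 \<in> {p + x * g * q | p q. p \<in> K}}"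
          using C0[OF uw(1,2)] y(2) uw(3) by auto
      next
        fix v assume "v \<in> {v \<in> carrier_vec 1. v $ 0 \<in> {p + x * g * q | p q. p \<in> K}}"
        then obtain p q where v: "v \<in> carrier_vec 1" "v $ 0 = p + x * g * q" "p \<in> K" by auto
        have "vec 1 (\<lambda>_. p) \<in> mat_image (D 0)" using v by (simp add: K(6))
        then obtain u where u: "u \<in> carrier_vec (b 1)" "vec 1 (\<lambda>_. p) = D 0 *\<^sub>v u"
          using mat_imageE[OF _ K(4)[of 0]] by (metis One_nat_def)
        let ?w = "vec 1 (\<lambda>_. q)"
        have v_eq: "v = C 0 *\<^sub>v (u @\<^sub>v ?w)"
        proof (rule eq_vecI)
          fix j assume "j < dim_vec (C 0 *\<^sub>v (u @\<^sub>v ?w))"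
          then have j: "j = 0" using c by simp
          show "v $ j = (C 0 *\<^sub>v (u @\<^sub>v ?w)) $ j"
            unfolding j using C0[OF u(1), of ?w] v(2) by (simp flip: u(2))
        qed (use v c in simp)
        have "u @\<^sub>v ?w \<in> carrier_vec (b 1 + 1)" by (rule append_carrier_vec[OF u(1) vec_carrier])
        then show "v \<in> mat_image (C 0)" unfolding v_eq by (rule mat_imageI[OF c])
      qed
    qed
  qed
  moreover have "b'' 0 = b 0" "b'' (Suc i) = b (Suc i) + b' i" for i unfolding b''_def by simp_all
  ultimately show thesis by (rule that)
qed

lemma ideal_resolution_zero:
  "ideal_resolution {0} (\<lambda>i. if i = 0 then 1 else 0) (\<lambda>_ _. 0)
     (\<lambda>i. 0\<^sub>m (if i = 0 then 1 else 0) 0 :: ('v::finite, 'k::field) mpoly mat)"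
proof -
  have carrier_0: "v = 0\<^sub>v 0" if "v \<in> carrier_vec 0" for v :: "('v, 'k) mpoly vec"
    by (rule eq_vecI) (use that in \<open>simp_all only: carrier_vecD index_zero_vec\<close>)
  have image: "v \<in> mat_image (0\<^sub>m n 0 :: ('v, 'k) mpoly mat) \<longleftrightarrow> v = 0\<^sub>v n" for n v
  proof
    assume "v \<in> mat_image (0\<^sub>m n 0)"
    then show "v = 0\<^sub>v n" by (rule mat_imageE[OF _ zero_carrier_mat]) (simp only: zero_mat_mult_vec)
  next
    assume "v = 0\<^sub>v n"
    then show "v \<in> mat_image (0\<^sub>m n 0)"
      using mat_imageI[OF zero_carrier_mat zero_carrier_vec, where 'a = "('v, 'k) mpoly", of n 0]
      by (simp only: zero_mat_mult_vec[OF zero_carrier_vec])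
  qed
  have kernel: "v \<in> mat_kernel (0\<^sub>m n 0 :: ('v, 'k) mpoly mat) \<longleftrightarrow> v = 0\<^sub>v 0" for n v
  proof
    assume "v \<in> mat_kernel (0\<^sub>m n 0)"
    then show "v = 0\<^sub>v 0" by (intro carrier_0 mat_kernelD(1)[OF zero_carrier_mat])
  next
    assume "v = 0\<^sub>v 0"
    then have "v \<in> carrier_vec 0" by (simp only: zero_carrier_vec)
    then show "v \<in> mat_kernel (0\<^sub>m n 0)"
      by (intro mat_kernelI[OF zero_carrier_mat] zero_mat_mult_vec)
  qed
  have vec_1: "v \<in> carrier_vec 1 \<and> v $ 0 \<in> {0} \<longleftrightarrow> v = 0\<^sub>v 1" for v :: "('v, 'k) mpoly vec"
    by (auto intro!: eq_vecI)
  show ?thesis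
    unfolding ideal_resolution_def
  proof (intro conjI allI impI)
    show "mat_image (0\<^sub>m (if 0 = (0::nat) then 1 else 0) 0) = {v :: ('v, 'k) mpoly vec. v \<in> carrier_vec 1 \<and> v $ 0 \<in> {0}}"
      unfolding vec_1 by (intro equalityI subsetI) (simp_all only: image mem_Collect_eq if_True simp_thms)
    show "mat_kernel (0\<^sub>m (if i = 0 then 1 else 0) 0) =
      mat_image (0\<^sub>m (if Suc i = 0 then 1 else 0) 0 :: ('v, 'k) mpoly mat)" for i
      by (intro equalityI subsetI) (simp_all only: image kernel nat.distinct if_False simp_thms)
  qed (simp_all add: graded_mat_def)
qed

section \<open>From ideals to quotient modules\<close>

text \<open>The module axioms are ring axioms of the quotient ring, as scalars act through the quotient homomorphism.\<close>

lemma module_quotient_module: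
  fixes I :: "'a::comm_ring_1 set"
  assumes I: "ideal I class_ring"
  shows "Module.module class_ring (quotient_module class_ring I)"
proof -
  let ?R = "class_ring :: 'a ring" and ?Q = "class_ring Quot I" and ?M = "quotient_module class_ring I"
  interpret Q: ring ?Q by (rule ideal.quotient_is_ring[OF I])
  have h: "(+>\<^bsub>?R\<^esub>) I \<in> Ring.ring_hom ?R ?Q" by (rule ideal.rcos_ring_hom[OF I])
  note hc = ring_hom_closed[OF h] and hm = ring_hom_mult[OF h] and ha = ring_hom_add[OF h]
    and h1 = ring_hom_one[OF h]
  have M: "carrier ?M = carrier ?Q" "add ?M = add ?Q" "zero ?M = zero ?Q"
    "module.smult ?M = (\<lambda>a C. (I +>\<^bsub>?R\<^esub> a) \<otimes>\<^bsub>?Q\<^esub> C)"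
    by (simp_all add: quotient_module_def)
  show ?thesis
  proof (rule moduleI)
    show "cring ?R" by (rule class_cring.cring_axioms)
    show "abelian_group ?M"
    proof (rule abelian_groupI)
      fix x assume "x \<in> carrier ?M"
      then show "\<exists>y\<in>carrier ?M. y \<oplus>\<^bsub>?M\<^esub> x = \<zero>\<^bsub>?M\<^esub>"
        using Q.a_inv_closed[of x] Q.l_neg[of x] by (auto simp: M)
    next
      fix x y assume "x \<in> carrier ?M" "y \<in> carrier ?M"
      then show "x \<oplus>\<^bsub>?M\<^esub> y = y \<oplus>\<^bsub>?M\<^esub> x" unfolding M by (rule Q.a_comm)
    qed (simp_all add: M Q.a_assoc)
  qed (use hc hm ha h1 in \<open>simp_all add: M Q.l_distr Q.r_distr Q.m_assoc\<close>)
qed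

lemma minimal_resolution_of_quotient:
  fixes I :: "('v::finite, 'k::field) mpoly set"
  assumes I: "ideal I class_ring" and res: "ideal_resolution I b a D"
  shows "minimal_graded_free_resolution (quotient_module class_ring I) (quotient_grading I) b a D
    (\<lambda>v. I +>\<^bsub>class_ring\<^esub> v $ 0)"
proof -
  let ?R = "class_ring :: ('v, 'k) mpoly ring" and ?Q = "class_ring Quot I"
  let ?M = "quotient_module class_ring I" and ?e = "\<lambda>v. I +>\<^bsub>class_ring\<^esub> v $ 0"
  note R = ideal_resolutionD[OF res]
  have h: "(+>\<^bsub>?R\<^esub>) I \<in> Ring.ring_hom ?R ?Q" by (rule ideal.rcos_ring_hom[OF I])
  note hc = ring_hom_closed[OF h] and hm = ring_hom_mult[OF h] and ha = ring_hom_add[OF h]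
  interpret ideal I ?R by (rule I)
  have M: "carrier ?M = carrier ?Q" "add ?M = add ?Q" "zero ?M = I"
    "module.smult ?M = (\<lambda>a C. (I +>\<^bsub>?R\<^esub> a) \<otimes>\<^bsub>?Q\<^esub> C)"
    by (simp_all add: quotient_module_def FactRing_def)
  have e_hom: "?e \<in> LinearCombinations.module_hom class_ring (module_vec TYPE(('v, 'k) mpoly) (b 0)) ?M"
    using hc hm ha R(1) by (auto simp: LinearCombinations.module_hom_def module_vec_simps M)
  have surj: "?e ` carrier_vec (b 0) = carrier ?M"
  proof -
    have "carrier ?Q = range ((+>\<^bsub>?R\<^esub>) I)"
      by (auto simp: FactRing_def A_RCOSETS_def RCOSETS_def a_r_coset_def)
    also have "\<dots> = ?e ` carrier_vec (b 0)"
    proof (intro equalityI subsetI)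
      fix C assume "C \<in> range ((+>\<^bsub>?R\<^esub>) I)"
      then obtain p where "C = I +>\<^bsub>?R\<^esub> p" by auto
      then show "C \<in> ?e ` carrier_vec (b 0)"
        using R(1) by (intro image_eqI[of _ _ "vec 1 (\<lambda>_. p)"]) simp_all
    qed auto
    finally show ?thesis by (simp add: M)
  qed
  have "I +>\<^bsub>?R\<^esub> p = I \<longleftrightarrow> p \<in> I" for p
    using a_rcos_self[of p] a_rcos_const[of p] by auto
  then have kernel: "{v \<in> carrier_vec (b 0). ?e v = \<zero>\<^bsub>?M\<^esub>} = mat_image (D 0)"
    by (simp add: M R(1) R(6))
  have image: "mat_image (D i) = (\<lambda>w. D i *\<^sub>v w) ` carrier_vec (b (Suc i))" for i
    using R(4)[of i] by (simp add: mat_image_def)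
  have "graded_free_resolution ?M (quotient_grading I) b a D ?e"
    unfolding graded_free_resolution_def
  proof (intro conjI allI ballI)
    fix d and v :: "('v, 'k) mpoly vec" assume "v \<in> free_grading (b 0) (a 0) d"
    then show "?e v \<in> quotient_grading I d"
      using R(1,2) by (auto simp: free_grading_def quotient_grading_def)
  next
    fix i d and v :: "('v, 'k) mpoly vec" assume "v \<in> free_grading (b (Suc i)) (a (Suc i)) d"
    then show "D i *\<^sub>v v \<in> free_grading (b i) (a i) d" by (rule graded_mat_free_grading[OF R(3)])
  qed (use R(4,7) e_hom surj kernel in \<open>simp_all flip: image\<close>)
  moreover have "map_mat constant_coeff (D i) = 0\<^sub>m (b i) (b (Suc i))" for i
    using R(4)[of i] R(5)[of _ i] by (intro eq_matI) auto
  ultimately show ?thesis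
    using minimal_iff_constant_coeff_zero[OF R(4)] by (simp add: minimal_graded_free_resolution_def)
qed

lemma proj_dim_quotient_eqI:
  assumes "ideal I class_ring" "ideal_resolution I b a D" "resolution_length b p"
  shows "proj_dim_quotient I = p"
  unfolding proj_dim_quotient_def
  using proj_dim_eqI[OF module_quotient_module minimal_resolution_of_quotient] assms by blast

section \<open>Adding a monomial to a monomial ideal\<close>

definition resolvable :: "('v::finite, 'k::field) mpoly set \<Rightarrow> nat \<Rightarrow> bool" where
  "resolvable K p \<longleftrightarrow> (\<exists>b a D. ideal_resolution K b a D \<and> resolution_length b p)"

lemma resolvable_zero: "resolvable ({0} :: ('v::finite, 'k::field) mpoly set) 0"
  unfolding resolvable_def by (intro exI conjI, rule ideal_resolution_zero) (simp add: resolution_length_def)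

text \<open>Since the rank of the cone in place \<open>i + 1\<close> is \<open>b (i + 1) + b' i\<close>, its length is the larger of \<open>p\<close> and \<open>q + 1\<close>.\<close>

lemma resolvable_cone:
  fixes K L :: "('v::finite, 'k::field) mpoly set"
  assumes "resolvable K p" "resolvable L q"
    and x: "x \<in> homogeneous_part e" "constant_coeff x = 0"
    and g: "g \<in> homogeneous_part d" "\<And>f. f \<in> L \<Longrightarrow> g * f \<in> K"
    and xg: "\<And>f. x * g * f \<in> K \<Longrightarrow> f \<in> L"
  shows "resolvable {f + x * g * f' | f f'. f \<in> K} (max p (Suc q))"
proof -
  obtain b a D where K: "ideal_resolution K b a D" "resolution_length b p"
    using assms(1) by (auto simp: resolvable_def)
  obtain b' a' D' where L: "ideal_resolution L b' a' D'" "resolution_length b' q"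
    using assms(2) by (auto simp: resolvable_def)
  obtain b'' a'' D'' where C: "ideal_resolution {f + x * g * f' | f f'. f \<in> K} b'' a'' D''"
    "b'' 0 = b 0" "\<And>i. b'' (Suc i) = b (Suc i) + b' i"
    by (rule ideal_resolution_cone[OF K(1) L(1) x g xg], assumption+, rule that)
  have "resolution_length b'' (max p (Suc q))"
    unfolding resolution_length_def
  proof (intro conjI allI impI)
    show "b'' (max p (Suc q)) \<noteq> 0"
    proof (cases "Suc q \<le> p")
      case True
      then obtain p' where "p = Suc p'" by (cases p) auto
      then show ?thesis using True K(2) C(3)[of p'] by (simp add: resolution_length_def max_absorb1)
    next
      case False
      then have "max p (Suc q) = Suc q" by simp
      then show ?thesis using L(2) C(3)[of q] by (simp add: resolution_length_def)
    qed
    fix i assume i: "max p (Suc q) < i"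
    then obtain i' where "i = Suc i'" by (cases i) auto
    then show "b'' i = 0" using i K(2) L(2) C(3)[of i'] by (simp add: resolution_length_def)
  qed
  with C(1) show ?thesis by (auto simp: resolvable_def)
qed

text \<open>A polynomial with exponents in the union is split into its terms with exponent in \<open>U\<close> and the remaining ones, which are
all divisible by the monomial with exponent \<open>m\<close>.\<close>

lemma monomial_ideal_insert:
  "{f + Poly_Mapping.single m 1 * f' | f f'. f \<in> monomial_ideal U} =
     (monomial_ideal (U \<union> range ((+) m)) :: ('v, 'k::field) mpoly set)" (is "?L = ?R")
proof (intro equalityI subsetI)
  fix h assume "h \<in> ?L"
  then obtain f f' where h: "h = f + Poly_Mapping.single m 1 * f'" "f \<in> monomial_ideal U" by auto
  have "Poly_Mapping.keys (Poly_Mapping.single m 1 * f') \<subseteq> range ((+) m)"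
    using keys_mult[of "Poly_Mapping.single m 1" f'] by auto
  then show "h \<in> ?R"
    using h keys_add[of f "Poly_Mapping.single m 1 * f'"] by (auto simp: monomial_ideal_def)
next
  fix h :: "('v, 'k) mpoly" assume h: "h \<in> ?R"
  define f where "f = (\<Sum>t\<in>Poly_Mapping.keys h \<inter> U. Poly_Mapping.single t (Poly_Mapping.lookup h t))"
  define f' where "f' = (\<Sum>t\<in>Poly_Mapping.keys h - U. Poly_Mapping.single (t - m) (Poly_Mapping.lookup h t))"
  have "Poly_Mapping.keys f \<subseteq> (\<Union>t\<in>Poly_Mapping.keys h \<inter> U.
      Poly_Mapping.keys (Poly_Mapping.single t (Poly_Mapping.lookup h t)))"
    unfolding f_def by (rule keys_sum)
  then have f: "f \<in> monomial_ideal U" by (force simp: monomial_ideal_def split: if_splits)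
  have "Poly_Mapping.single m 1 * f' =
      (\<Sum>t\<in>Poly_Mapping.keys h - U. Poly_Mapping.single t (Poly_Mapping.lookup h t))"
    unfolding f'_def sum_distrib_left
  proof (rule sum.cong)
    fix t assume "t \<in> Poly_Mapping.keys h - U"
    then obtain s where "t = m + s" using h by (auto simp: monomial_ideal_def)
    then show "Poly_Mapping.single m 1 * Poly_Mapping.single (t - m) (Poly_Mapping.lookup h t) =
        Poly_Mapping.single t (Poly_Mapping.lookup h t)"
      by (simp add: mult_single)
  qed simp
  then have "f + Poly_Mapping.single m 1 * f' =
      (\<Sum>t\<in>Poly_Mapping.keys h. Poly_Mapping.single t (Poly_Mapping.lookup h t))"
    unfolding f_def by (simp add: sum.Int_Diff[OF finite_keys, of _ h U])
  then have "h = f + Poly_Mapping.single m 1 * f'" by (simp add: sum_of_monomials)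
  with f show "h \<in> ?L" by blast
qed

text \<open>The monomial that is added is the product of the variable \<open>v\<close> and the monomial with exponent \<open>s\<close>. The last hypothesis
says that the colon ideal does not change if the factor \<open>v\<close> is dropped; it is what allows
the chain map of the cone to be divisible by a variable.\<close>

lemma resolvable_insert_monomial:
  fixes U :: "('v::finite \<Rightarrow>\<^sub>0 nat) set" and v :: 'v
  assumes U: "resolvable (monomial_ideal U :: ('v, 'k::field) mpoly set) p"
    and colon: "resolvable (monomial_ideal {t. s + t \<in> U} :: ('v, 'k) mpoly set) q"
    and v: "\<And>t. Poly_Mapping.single v 1 + s + t \<in> U \<Longrightarrow> s + t \<in> U"
  shows "resolvable (monomial_ideal (U \<union> range ((+) (Poly_Mapping.single v 1 + s))) :: ('v, 'k) mpoly set)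
    (max p (Suc q))"
proof -
  let ?x = "Poly_Mapping.single (Poly_Mapping.single v 1) 1 :: ('v, 'k) mpoly"
  let ?g = "Poly_Mapping.single s 1 :: ('v, 'k) mpoly"
  have xg: "?x * ?g = Poly_Mapping.single (Poly_Mapping.single v 1 + s) 1" by (simp add: mult_single)
  have "Poly_Mapping.single v (1::nat) \<noteq> 0"
    by (metis lookup_single_eq lookup_zero zero_neq_one)
  then have x0: "constant_coeff ?x = 0" by (simp add: lookup_single)
  have "resolvable {f + ?x * ?g * f' | f f'. f \<in> monomial_ideal U} (max p (Suc q))"
  proof (rule resolvable_cone[OF U colon monomial_homogeneous x0 monomial_homogeneous])
    fix f :: "('v, 'k) mpoly" assume "f \<in> monomial_ideal {t. s + t \<in> U}"
    then show "?g * f \<in> monomial_ideal U"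
      using keys_mult[of ?g f] by (auto simp: monomial_ideal_def)
  next
    fix f :: "('v, 'k) mpoly" assume f: "?x * ?g * f \<in> monomial_ideal U"
    show "f \<in> monomial_ideal {t. s + t \<in> U}"
      unfolding monomial_ideal_def
    proof (intro CollectI subsetI)
      fix t assume "t \<in> Poly_Mapping.keys f"
      then have "Poly_Mapping.lookup (?x * ?g * f) (Poly_Mapping.single v 1 + s + t) \<noteq> 0"
        unfolding xg lookup_monomial_mult by (simp add: in_keys_iff)
      then have "Poly_Mapping.single v 1 + s + t \<in> U"
        using f by (auto simp: monomial_ideal_def in_keys_iff)
      then show "s + t \<in> U" by (rule v)
    qed
  qed
  then show ?thesis unfolding xg monomial_ideal_insert .
qed

section \<open>Forests\<close>

text \<open>A forest is given by a parent function, and its edges join the elements \<open>v\<close> of \<open>X\<close> to \<open>par v\<close>. Shrinking \<open>X\<close> removes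
edges and keeps all vertices, so that every subgraph needed in the recursion is again of this form.\<close>

definition adj :: "('v \<Rightarrow> 'v) \<Rightarrow> 'v set \<Rightarrow> 'v \<Rightarrow> 'v \<Rightarrow> bool" where
  "adj par X u v \<longleftrightarrow> u \<in> X \<and> par u = v \<or> v \<in> X \<and> par v = u"

definition nbhd :: "('v \<Rightarrow> 'v) \<Rightarrow> 'v set \<Rightarrow> 'v set \<Rightarrow> 'v set" where
  "nbhd par X A = {v. \<exists>a\<in>A. adj par X a v}"

definition indep :: "('v \<Rightarrow> 'v) \<Rightarrow> 'v set \<Rightarrow> 'v set \<Rightarrow> bool" where
  "indep par X A \<longleftrightarrow> (\<forall>a\<in>A. \<forall>b\<in>A. \<not> adj par X a b)"

text \<open>The largest number of vertices that have a neighbour in a common independent set. For graphs this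
is the maximal size of a minimal vertex cover: the complement of a maximal independent set is the set of
its neighbours.\<close>

definition dominated_max :: "('v \<Rightarrow> 'v) \<Rightarrow> 'v set \<Rightarrow> nat \<Rightarrow> bool" where
  "dominated_max par X n \<longleftrightarrow> (\<exists>A. indep par X A \<and> n \<le> card (nbhd par X A)) \<and>
     (\<forall>A. indep par X A \<longrightarrow> card (nbhd par X A) \<le> n)"

text \<open>The exponents of the monomials in the ideal generated by the edges and by the variables in \<open>W\<close>.\<close>

definition cover_exponents :: "('v \<Rightarrow> 'v) \<Rightarrow> 'v set \<Rightarrow> 'v set \<Rightarrow> ('v \<Rightarrow>\<^sub>0 nat) set" where
  "cover_exponents par X W = {t. (\<exists>w\<in>W. Poly_Mapping.lookup t w \<noteq> 0) \<or>
     (\<exists>u v. adj par X u v \<and> Poly_Mapping.lookup t u \<noteq> 0 \<and> Poly_Mapping.lookup t v \<noteq> 0)}"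

lemma single_add_range_iff:
  fixes t :: "'v \<Rightarrow>\<^sub>0 nat"
  shows "t \<in> range ((+) (Poly_Mapping.single z 1)) \<longleftrightarrow> Poly_Mapping.lookup t z \<noteq> 0"
proof
  assume "Poly_Mapping.lookup t z \<noteq> 0"
  then have "t = Poly_Mapping.single z 1 + (t - Poly_Mapping.single z 1)"
    by (intro poly_mapping_eqI) (auto simp: lookup_add lookup_minus lookup_single when_def)
  then show "t \<in> range ((+) (Poly_Mapping.single z 1))" by blast
qed (auto simp: lookup_add)

lemma single_add_single_range_iff:
  fixes t :: "'v \<Rightarrow>\<^sub>0 nat"
  assumes "y \<noteq> z"
  shows "t \<in> range ((+) (Poly_Mapping.single y 1 + Poly_Mapping.single z 1)) \<longleftrightarrow>
    Poly_Mapping.lookup t y \<noteq> 0 \<and> Poly_Mapping.lookup t z \<noteq> 0"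
proof
  assume "Poly_Mapping.lookup t y \<noteq> 0 \<and> Poly_Mapping.lookup t z \<noteq> 0"
  then have "t = Poly_Mapping.single y 1 + Poly_Mapping.single z 1 +
      (t - (Poly_Mapping.single y 1 + Poly_Mapping.single z 1))"
    using assms by (intro poly_mapping_eqI) (auto simp: lookup_add lookup_minus lookup_single when_def)
  then show "t \<in> range ((+) (Poly_Mapping.single y 1 + Poly_Mapping.single z 1))" by blast
qed (auto simp: lookup_add)

text \<open>A variable that occurs in no edge is a nonzerodivisor modulo the ideal, so the cone is taken over the
multiplication by that variable, with \<open>g = 1\<close> and \<open>L = K\<close>.\<close>

lemma resolvable_variables:
  fixes W :: "'v::finite set"
  assumes "resolvable (monomial_ideal (cover_exponents par X {}) :: ('v, 'k::field) mpoly set) p"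
    and "\<And>u v. adj par X u v \<Longrightarrow> u \<notin> W"
  shows "resolvable (monomial_ideal (cover_exponents par X W) :: ('v, 'k) mpoly set) (p + card W)"
  using finite[of W] assms(2)
proof (induction W rule: finite_induct)
  case empty
  then show ?case using assms(1) by simp
next
  case (insert z W)
  let ?U = "cover_exponents par X W"
  have IH: "resolvable (monomial_ideal ?U :: ('v, 'k) mpoly set) (p + card W)"
    using insert by blast
  have z: "\<not> adj par X z v" "\<not> adj par X v z" for v
    using insert.prems[of z v] by (auto simp: adj_def)
  have z': "Poly_Mapping.single z 1 + t \<in> ?U \<longleftrightarrow> t \<in> ?U" for t
  proof -
    have "Poly_Mapping.lookup (Poly_Mapping.single z 1 + t) u = Poly_Mapping.lookup t u" if "u \<noteq> z" for u
      using that by (simp add: lookup_add lookup_single)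
    moreover have "u \<noteq> z \<and> v \<noteq> z" if "adj par X u v" for u v using that z by blast
    moreover have "w \<noteq> z" if "w \<in> W" for w using that insert.hyps by blast
    ultimately show ?thesis unfolding cover_exponents_def mem_Collect_eq by metis
  qed
  have "resolvable (monomial_ideal (?U \<union> range ((+) (Poly_Mapping.single z 1 + 0))) :: ('v, 'k) mpoly set)
      (max (p + card W) (Suc (p + card W)))"
    by (rule resolvable_insert_monomial) (use IH z' in auto)
  moreover have "?U \<union> range ((+) (Poly_Mapping.single z 1)) = cover_exponents par X (insert z W)"
    unfolding set_eq_iff Un_iff single_add_range_iff by (auto simp: cover_exponents_def)
  ultimately show ?case using insert.hyps by simp
qed

text \<open>One step of the recursion: \<open>x\<close> is a vertex without children and \<open>y\<close> its parent. \<open>X'\<close> is the forest without the edge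
\<open>xy\<close>, the set \<open>N\<close> consists of the other neighbours of \<open>y\<close>, and \<open>X''\<close> keeps the edges of \<open>X'\<close> that meet neither
\<open>y\<close> nor \<open>N\<close>.\<close>

locale leaf_edge =
  fixes par :: "'v::finite \<Rightarrow> 'v" and X :: "'v set" and x :: 'v
  assumes x: "x \<in> X" and leaf: "\<And>w. w \<in> X \<Longrightarrow> par w \<noteq> x" and irrefl: "\<And>w. w \<in> X \<Longrightarrow> par w \<noteq> w"
begin

definition "y = par x"
definition "X' = X - {x}"
definition "N = {v. adj par X' y v}"
definition "X'' = {w \<in> X'. w \<notin> insert y N \<and> par w \<notin> insert y N}"

lemma x_neq_y: "x \<noteq> y" using irrefl[OF x] by (simp add: y_def)

lemma adj_sym: "adj par Y u v \<longleftrightarrow> adj par Y v u"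
  by (auto simp: adj_def)

lemma adj_X: "adj par X u v \<longleftrightarrow> adj par X' u v \<or> (u = x \<and> v = y) \<or> (u = y \<and> v = x)"
  using x by (auto simp: adj_def X'_def y_def)

lemma adj_X': "adj par X' u v \<Longrightarrow> u \<noteq> x \<and> v \<noteq> x \<and> u \<noteq> v"
  using leaf[of u] leaf[of v] irrefl[of u] irrefl[of v] by (auto simp: adj_def X'_def)

lemma adj_X'': "adj par X'' u v \<longleftrightarrow> adj par X' u v \<and> u \<notin> insert y N \<and> v \<notin> insert y N"
  by (auto simp: adj_def X''_def)

lemma N_iff: "v \<in> N \<longleftrightarrow> adj par X' y v" by (simp add: N_def)

lemma x_y_notin_N: "x \<notin> N" "y \<notin> N" using adj_X' by (auto simp: N_iff)

text \<open>The colon ideal of \<open>X'\<close> by \<open>y\<close>: an edge at \<open>y\<close> turns into the variable of its other end, which lies in \<open>N\<close>,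
and absorbs all edges at that vertex. As \<open>x\<close> meets no edge of \<open>X'\<close>, a further factor \<open>x\<close> makes no
difference.\<close>

lemma resolvable_leaf_edge:
  assumes K: "resolvable (monomial_ideal (cover_exponents par X' {}) :: ('v, 'k::field) mpoly set) p"
    and L: "resolvable (monomial_ideal (cover_exponents par X'' {}) :: ('v, 'k) mpoly set) q"
  shows "resolvable (monomial_ideal (cover_exponents par X {}) :: ('v, 'k) mpoly set)
    (max p (Suc (q + card N)))"
proof -
  let ?U = "cover_exponents par X' {}"
  have lookup_y: "Poly_Mapping.lookup (Poly_Mapping.single y 1 + t) u \<noteq> 0 \<longleftrightarrow>
      u = y \<or> Poly_Mapping.lookup t u \<noteq> 0" for t :: "'v \<Rightarrow>\<^sub>0 nat" and u
    by (auto simp: lookup_add lookup_single when_def)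
  have colon: "{t. Poly_Mapping.single y 1 + t \<in> ?U} = cover_exponents par X'' N"
  proof (intro equalityI subsetI)
    fix t assume "t \<in> {t. Poly_Mapping.single y 1 + t \<in> ?U}"
    then obtain u v where uv: "adj par X' u v" "u = y \<or> Poly_Mapping.lookup t u \<noteq> 0"
      "v = y \<or> Poly_Mapping.lookup t v \<noteq> 0"
      unfolding cover_exponents_def mem_Collect_eq lookup_y by blast
    show "t \<in> cover_exponents par X'' N"
    proof (cases "\<exists>w\<in>N. Poly_Mapping.lookup t w \<noteq> 0")
      case True
      then show ?thesis by (simp add: cover_exponents_def)
    next
      case False
      then have "u \<noteq> y" "v \<noteq> y" using uv adj_X'[OF uv(1)] adj_sym[of X' u v] by (auto simp: N_iff)
      then have "adj par X'' u v" using uv False by (auto simp: adj_X'')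
      then show ?thesis using uv \<open>u \<noteq> y\<close> \<open>v \<noteq> y\<close> unfolding cover_exponents_def by blast
    qed
  next
    fix t assume "t \<in> cover_exponents par X'' N"
    then consider w where "w \<in> N" "Poly_Mapping.lookup t w \<noteq> 0"
      | u v where "adj par X'' u v" "Poly_Mapping.lookup t u \<noteq> 0" "Poly_Mapping.lookup t v \<noteq> 0"
      unfolding cover_exponents_def by blast
    then have "\<exists>u v. adj par X' u v \<and> (u = y \<or> Poly_Mapping.lookup t u \<noteq> 0) \<and>
      (v = y \<or> Poly_Mapping.lookup t v \<noteq> 0)"
    proof cases
      case 1
      then have "adj par X' y w" by (simp add: N_iff)
      with 1 show ?thesis by blast
    next
      case 2
      then have "adj par X' u v" by (simp add: adj_X'')
      with 2 show ?thesis by blast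
    qed
    then show "t \<in> {t. Poly_Mapping.single y 1 + t \<in> ?U}"
      unfolding cover_exponents_def mem_Collect_eq lookup_y by simp
  qed
  have "resolvable (monomial_ideal (cover_exponents par X'' N) :: ('v, 'k) mpoly set) (q + card N)"
    by (rule resolvable_variables[OF L]) (simp add: adj_X'')
  then have colon': "resolvable (monomial_ideal {t. Poly_Mapping.single y 1 + t \<in> ?U} :: ('v, 'k) mpoly set)
      (q + card N)"
    unfolding colon .
  have "Poly_Mapping.single y 1 + t \<in> ?U" if t: "Poly_Mapping.single x 1 + Poly_Mapping.single y 1 + t \<in> ?U"
    for t :: "'v \<Rightarrow>\<^sub>0 nat"
  proof -
    obtain u v where uv: "adj par X' u v"
      "Poly_Mapping.lookup (Poly_Mapping.single x 1 + Poly_Mapping.single y 1 + t) u \<noteq> 0"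
      "Poly_Mapping.lookup (Poly_Mapping.single x 1 + Poly_Mapping.single y 1 + t) v \<noteq> 0"
      using t unfolding cover_exponents_def by blast
    have "u \<noteq> x" "v \<noteq> x" using adj_X'[OF uv(1)] by auto
    with uv(2,3) have "Poly_Mapping.lookup (Poly_Mapping.single y 1 + t) u \<noteq> 0"
      "Poly_Mapping.lookup (Poly_Mapping.single y 1 + t) v \<noteq> 0"
      by (simp_all add: lookup_add lookup_single)
    with uv(1) show ?thesis unfolding cover_exponents_def by blast
  qed
  from resolvable_insert_monomial[OF K colon' this]
  have "resolvable (monomial_ideal (?U \<union> range ((+) (Poly_Mapping.single x 1 + Poly_Mapping.single y 1)))
      :: ('v, 'k) mpoly set) (max p (Suc (q + card N)))" .
  moreover have "?U \<union> range ((+) (Poly_Mapping.single x 1 + Poly_Mapping.single y 1)) =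
      cover_exponents par X {}"
    unfolding set_eq_iff Un_iff single_add_single_range_iff[OF x_neq_y] cover_exponents_def mem_Collect_eq adj_X
    by blast
  ultimately show ?thesis by simp
qed

lemma in_nbhd_cases:
  assumes "adj par X' a v" "a \<in> A" "a \<notin> insert y N" "v \<noteq> y"
  shows "v \<in> N \<union> nbhd par X'' A"
proof (cases "v \<in> N")
  case False
  with assms have "adj par X'' a v" by (simp add: adj_X'')
  with assms(2) show ?thesis unfolding nbhd_def by blast
qed simp

lemma indep_mono:
  assumes "indep par Y A" "\<And>a b. adj par Z a b \<Longrightarrow> adj par Y a b"
  shows "indep par Z A"
  using assms unfolding indep_def by blast

lemma indep_X': "indep par X A \<Longrightarrow> indep par X' A"
  by (erule indep_mono) (simp add: adj_X)

lemma indep_X'': "indep par X A \<Longrightarrow> indep par X'' A"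
  by (erule indep_mono) (simp add: adj_X adj_X'')

text \<open>If \<open>xy\<close> makes a difference for the vertices dominated by \<open>A\<close>, then either \<open>y\<close> is in \<open>A\<close>, or \<open>x\<close> is in \<open>A\<close>
and is the only neighbour of \<open>y\<close> there. In both cases \<open>A\<close> avoids \<open>N\<close> and dominates just one of \<open>x\<close> and \<open>y\<close>, so
that the remaining dominated vertices lie in \<open>N\<close> or are dominated in \<open>X''\<close>.\<close>

lemma nbhd_X_bound:
  assumes A: "indep par X A" and not_sub: "\<not> nbhd par X A \<subseteq> nbhd par X' A"
  shows "\<exists>z. nbhd par X A \<subseteq> insert z (N \<union> nbhd par X'' A)"
proof (cases "y \<in> A")
  case True
  have "v \<in> insert x (N \<union> nbhd par X'' A)" if "v \<in> nbhd par X A" for v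
  proof -
    obtain a where a: "a \<in> A" "adj par X a v" using \<open>v \<in> nbhd par X A\<close> unfolding nbhd_def by blast
    have "\<not> adj par X y a" "\<not> adj par X a y" using A a(1) True unfolding indep_def by simp_all
    then have a': "a \<notin> N" "a \<noteq> x" unfolding N_iff by (simp_all add: adj_X)
    have vy: "v \<noteq> y" using a(2) \<open>\<not> adj par X a y\<close> by metis
    have av: "adj par X' a v \<or> (a = y \<and> v = x)" using a(2) a'(2) by (simp add: adj_X)
    show ?thesis
    proof (cases "a = y")
      case True
      then have "v \<in> N \<or> v = x" using av by (simp add: N_iff)
      then show ?thesis by (elim disjE) simp_all
    next
      case False
      then have "adj par X' a v" using av by simp
      then show ?thesis using in_nbhd_cases[OF _ a(1) _ vy] a'(1) False by simp
    qed
  qed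
  then show ?thesis by (intro exI[of _ x] subsetI)
next
  case y: False
  obtain v where v: "v \<in> nbhd par X A" "v \<notin> nbhd par X' A" using not_sub by blast
  then obtain a where a: "a \<in> A" "adj par X a v" unfolding nbhd_def by blast
  have "\<not> adj par X' a v" using v(2) a(1) unfolding nbhd_def by blast
  moreover have "a \<noteq> y" using a(1) y by metis
  ultimately have "a = x" "v = y" using a(2) by (simp_all add: adj_X)
  have no_y: "\<not> adj par X' a' y" if "a' \<in> A" for a'
    using v(2) that \<open>v = y\<close> unfolding nbhd_def by blast
  have "w \<in> insert y (N \<union> nbhd par X'' A)" if "w \<in> nbhd par X A" for w
  proof (cases "w = y")
    case False
    obtain b where b: "b \<in> A" "adj par X b w" using \<open>w \<in> nbhd par X A\<close> unfolding nbhd_def by blast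
    have "b \<noteq> y" using b(1) y by metis
    then have "adj par X' b w" using b(2) False by (simp add: adj_X)
    moreover have "b \<notin> insert y N" using no_y[OF b(1)] \<open>b \<noteq> y\<close> adj_sym[of X' b y] by (simp add: N_iff)
    ultimately show ?thesis using in_nbhd_cases[OF _ b(1) _ False] by simp
  qed simp
  then show ?thesis by (intro exI[of _ y] subsetI)
qed

text \<open>Vertices of \<open>N\<close> and \<open>x\<close> are isolated in \<open>X''\<close>; they can be replaced by \<open>y\<close>, which dominates all of them.\<close>

lemma indep_extend:
  assumes B: "indep par X'' B"
  shows "indep par X (insert y (B - insert x N))" (is "indep par X ?B'")
  unfolding indep_def
proof (intro ballI notI)
  fix a b assume ab: "a \<in> ?B'" "b \<in> ?B'" "adj par X a b"
  have out: "a \<noteq> x" "b \<noteq> x" "a \<notin> N" "b \<notin> N"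
    using ab(1,2) x_neq_y x_y_notin_N by auto
  have ab': "adj par X' a b" using ab(3) out by (simp add: adj_X)
  then have ne: "a \<noteq> y" "b \<noteq> y"
    using out(3,4) adj_sym[of X' a b] by (auto simp: N_iff)
  then have "adj par X'' a b" using ab' out by (simp add: adj_X'')
  moreover have "a \<in> B" "b \<in> B" using ab(1,2) ne by simp_all
  ultimately show False using B unfolding indep_def by blast
qed

lemma nbhd_extend: "insert x (N \<union> nbhd par X'' B) \<subseteq> nbhd par X (insert y (B - insert x N))"
proof
  fix v assume "v \<in> insert x (N \<union> nbhd par X'' B)"
  then consider "v = x" | "v \<in> N" | a where "a \<in> B" "adj par X'' a v"
    unfolding nbhd_def by blast
  then show "v \<in> nbhd par X (insert y (B - insert x N))"
  proof cases
    case 1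
    then have "adj par X y v" by (simp add: adj_X)
    then show ?thesis unfolding nbhd_def by blast
  next
    case 2
    then have "adj par X y v" by (simp add: adj_X N_iff)
    then show ?thesis unfolding nbhd_def by blast
  next
    case 3
    then have "adj par X' a v" "a \<notin> N" by (simp_all add: adj_X'')
    then have "adj par X a v" "a \<in> B - insert x N" using adj_X' 3(1) by (simp_all add: adj_X)
    then show ?thesis unfolding nbhd_def by blast
  qed
qed

text \<open>The combinatorial counterpart of \<open>resolvable_leaf_edge\<close>. The summand \<open>card N\<close> stands for the
variables of the colon ideal there, and for the neighbours of \<open>y\<close> other than \<open>x\<close> here.\<close>

lemma dominated_max_leaf_edge:
  assumes p: "dominated_max par X' p" and q: "dominated_max par X'' q"
  shows "dominated_max par X (max p (Suc (q + card N)))"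
proof -
  have p_le: "card (nbhd par X' A) \<le> p" if "indep par X' A" for A
    using p that by (simp add: dominated_max_def)
  have q_le: "card (nbhd par X'' A) \<le> q" if "indep par X'' A" for A
    using q that by (simp add: dominated_max_def)
  have upper: "card (nbhd par X A) \<le> max p (Suc (q + card N))" if A: "indep par X A" for A
  proof (cases "nbhd par X A \<subseteq> nbhd par X' A")
    case True
    then show ?thesis using p_le[OF indep_X'[OF A]] card_mono[OF finite True] by simp
  next
    case False
    then obtain z where "nbhd par X A \<subseteq> insert z (N \<union> nbhd par X'' A)"
      using nbhd_X_bound[OF A] by blast
    then have "card (nbhd par X A) \<le> card (insert z (N \<union> nbhd par X'' A))"
      by (intro card_mono) auto
    also have "\<dots> \<le> Suc (card (N \<union> nbhd par X'' A))" by (rule card_insert_le_m1) auto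
    also have "\<dots> \<le> Suc (card N + card (nbhd par X'' A))" using card_Un_le by simp
    finally show ?thesis using q_le[OF indep_X''[OF A]] by simp
  qed
  obtain A where A: "indep par X' A" "p \<le> card (nbhd par X' A)"
    using p by (auto simp: dominated_max_def)
  obtain B where B: "indep par X'' B" "q \<le> card (nbhd par X'' B)"
    using q by (auto simp: dominated_max_def)
  have A_indep: "indep par X (A - {x})" using A(1) by (simp add: indep_def adj_X)
  have "nbhd par X' A \<subseteq> nbhd par X (A - {x})"
  proof
    fix v assume "v \<in> nbhd par X' A"
    then obtain a where a: "a \<in> A" "adj par X' a v" unfolding nbhd_def by blast
    then have "a \<in> A - {x}" "adj par X a v" using adj_X'[OF a(2)] by (simp_all add: adj_X)
    then show "v \<in> nbhd par X (A - {x})" unfolding nbhd_def by blast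
  qed
  then have A_le: "p \<le> card (nbhd par X (A - {x}))"
    using A(2) card_mono[OF finite] le_trans by blast
  have x_N: "x \<notin> N \<union> nbhd par X'' B"
  proof
    assume "x \<in> N \<union> nbhd par X'' B"
    then obtain a where "adj par X'' a x" using x_y_notin_N unfolding nbhd_def by blast
    then show False using adj_X'[of a x] by (simp add: adj_X'')
  qed
  have disj: "N \<inter> nbhd par X'' B = {}"
  proof -
    have "v \<notin> N" if "v \<in> nbhd par X'' B" for v
      using that by (auto simp: nbhd_def adj_X'')
    then show ?thesis by blast
  qed
  have "Suc (q + card N) \<le> card (insert x (N \<union> nbhd par X'' B))"
    using B(2) x_N disj by (simp add: card_Un_disjoint)
  also have "\<dots> \<le> card (nbhd par X (insert y (B - insert x N)))"
    by (rule card_mono[OF finite nbhd_extend])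
  finally have "\<exists>A. indep par X A \<and> Suc (q + card N) \<le> card (nbhd par X A)"
    using indep_extend[OF B(1)] by blast
  moreover have "\<exists>A. indep par X A \<and> p \<le> card (nbhd par X A)" using A_indep A_le by blast
  ultimately have "\<exists>A. indep par X A \<and> max p (Suc (q + card N)) \<le> card (nbhd par X A)"
    unfolding max_def by (cases "p \<le> Suc (q + card N)") simp_all
  then show ?thesis using upper unfolding dominated_max_def by blast
qed

end

text \<open>The leaf edge of the recursion is found at a vertex \<open>x\<close> of maximal level, which cannot be a parent.\<close>

lemma forest_resolvable:
  fixes par :: "'v::finite \<Rightarrow> 'v" and lev :: "'v \<Rightarrow> nat"
  assumes "\<And>v. v \<in> X \<Longrightarrow> lev (par v) < lev v"
  shows "\<exists>n. dominated_max par X n \<and>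
    resolvable (monomial_ideal (cover_exponents par X {}) :: ('v, 'k::field) mpoly set) n"
  using finite[of X] assms
proof (induction X rule: finite_psubset_induct)
  case (psubset X)
  show ?case
  proof (cases "X = {}")
    case True
    have "dominated_max par {} 0" by (auto simp: dominated_max_def nbhd_def indep_def adj_def)
    moreover have "monomial_ideal (cover_exponents par {} {}) = ({0} :: ('v, 'k) mpoly set)"
      by (auto simp: monomial_ideal_def cover_exponents_def adj_def)
    ultimately show ?thesis using True resolvable_zero by metis
  next
    case False
    have "Max (lev ` X) \<in> lev ` X" using False by (intro Max_in) auto
    then obtain x where x: "x \<in> X" "lev x = Max (lev ` X)" by auto
    have le: "lev w \<le> lev x" if "w \<in> X" for w using that x(2) by simp
    interpret leaf_edge par X x
    proof
      show "par w \<noteq> x" "par w \<noteq> w" if "w \<in> X" for w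
        using le[OF that] psubset.prems[OF that] by auto
    qed (rule x(1))
    have X': "X' \<subset> X" and X'': "X'' \<subset> X" using x(1) by (auto simp: X'_def X''_def)
    obtain p where "dominated_max par X' p"
      "resolvable (monomial_ideal (cover_exponents par X' {}) :: ('v, 'k) mpoly set) p"
      using psubset.IH[OF X'] X' psubset.prems by blast
    moreover obtain q where "dominated_max par X'' q"
      "resolvable (monomial_ideal (cover_exponents par X'' {}) :: ('v, 'k) mpoly set) q"
      using psubset.IH[OF X''] X'' psubset.prems by blast
    ultimately show ?thesis using dominated_max_leaf_edge resolvable_leaf_edge by blast
  qed
qed

section \<open>The structure of perfect binary trees\<close>

locale perfect_tree =
  fixes par :: "'v::finite \<Rightarrow> 'v" and lev :: "'v \<Rightarrow> nat" and r :: 'v and h :: nat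
  assumes lev_zero_iff: "lev v = 0 \<longleftrightarrow> v = r"
    and lev_par: "v \<noteq> r \<Longrightarrow> lev v = Suc (lev (par v))"
    and lev_le: "lev v \<le> h"
    and children_2: "lev v < h \<Longrightarrow> card {w. w \<noteq> r \<and> par w = v} = 2"

lemma graph_dist_walk:
  assumes "connected_graph E"
  obtains xs where "walk_betw E u xs v" "length xs = Suc (graph_dist E u v)"
proof -
  obtain xs where xs: "walk_betw E u xs v" using assms unfolding connected_graph_def by blast
  then have "xs \<noteq> []" by (simp add: walk_betw_def walk_def)
  then have "length xs = Suc (length xs - 1)" by (cases xs) simp_all
  with xs have "\<exists>k xs. walk_betw E u xs v \<and> length xs = Suc k" by blast
  from LeastI_ex[OF this] show thesis using that unfolding graph_dist_def by blast
qed

lemma graph_dist_le: "walk_betw E u xs v \<Longrightarrow> length xs = Suc k \<Longrightarrow> graph_dist E u v \<le> k"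
  unfolding graph_dist_def by (rule Least_le) blast

lemma graph_dist_self: "graph_dist E r r = 0"
  using graph_dist_le[of E r "[r]" r 0] by (simp add: walk_betw_def walk_def)

lemma graph_dist_zero:
  assumes "connected_graph E" "graph_dist E r v = 0"
  shows "v = r"
proof -
  obtain xs where xs: "walk_betw E r xs v" "length xs = Suc 0"
    using graph_dist_walk[OF assms(1), of r v] assms(2) by metis
  then obtain a where "xs = [a]" by (auto simp: length_Suc_conv)
  with xs(1) show ?thesis by (auto simp: walk_betw_def)
qed

lemma graph_dist_edge:
  assumes "connected_graph E" "{u, v} \<in> E"
  shows "graph_dist E r v \<le> Suc (graph_dist E r u)"
proof -
  obtain xs where xs: "walk_betw E r xs u" "length xs = Suc (graph_dist E r u)"
    by (rule graph_dist_walk[OF assms(1)])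
  then have "walk_betw E r (xs @ [v]) v"
    using assms(2) by (auto simp: walk_betw_def walk_def successively_append_iff)
  then show ?thesis by (rule graph_dist_le) (simp add: xs(2))
qed

lemma graph_dist_predecessor:
  assumes "connected_graph E" "v \<noteq> r"
  obtains u where "{u, v} \<in> E" "graph_dist E r v = Suc (graph_dist E r u)"
proof -
  obtain xs where xs: "walk_betw E r xs v" "length xs = Suc (graph_dist E r v)"
    by (rule graph_dist_walk[OF assms(1)])
  define ys where "ys = butlast xs"
  have xs_eq: "xs = ys @ [v]" using xs(1) by (auto simp: walk_betw_def walk_def ys_def)
  have ys: "ys \<noteq> []" using xs(1) assms(2) xs_eq by (auto simp: walk_betw_def)
  have edge: "{last ys, v} \<in> E" and "walk_betw E r ys (last ys)"
    using xs(1) ys unfolding xs_eq by (auto simp: walk_betw_def walk_def successively_append_iff)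
  moreover have len: "length ys = graph_dist E r v" using xs(2) xs_eq by simp
  moreover obtain k where k: "length ys = Suc k" using ys by (cases ys) auto
  ultimately have "graph_dist E r (last ys) \<le> k" using graph_dist_le by metis
  then have "graph_dist E r v = Suc (graph_dist E r (last ys))"
    using len k graph_dist_edge[OF assms(1) edge, of r] by simp
  with edge show thesis by (rule that)
qed

lemma walk_of_rtrancl_path:
  assumes "rtrancl_path R x xs y" and "\<And>a b. R a b \<Longrightarrow> {a, b} \<in> E \<and> b \<noteq> w"
  shows "successively (\<lambda>u v. {u, v} \<in> E) (x # xs) \<and> last (x # xs) = y \<and> w \<notin> set xs"
  using assms
proof (induction rule: rtrancl_path.induct)
  case (step x y ys z)
  then have "successively (\<lambda>u v. {u, v} \<in> E) (y # ys)" "last (y # ys) = z" "w \<notin> set ys" by blast+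
  then show ?case using step.prems[OF step.hyps(1)] by auto
qed simp

text \<open>Two neighbours of \<open>w\<close> that are both connected to the root without passing through \<open>w\<close> lie on
  a cycle through \<open>w\<close>.\<close>

lemma acyclic_unique_predecessor:
  assumes T: "tree_graph E"
    and u: "{w, u} \<in> E" "graph_dist E r u \<le> graph_dist E r w"
    and u': "{w, u'} \<in> E" "graph_dist E r u' \<le> graph_dist E r w"
  shows "u = u'"
proof (rule ccontr)
  assume neq: "u \<noteq> u'"
  have conn: "connected_graph E" using T by (simp add: tree_graph_def)
  have irrefl: "a \<noteq> b" if "{a, b} \<in> E" for a b
    using T that by (fastforce simp: tree_graph_def simple_graph_def)
  define R where "R a b \<longleftrightarrow> {a, b} \<in> E \<and> a \<noteq> w \<and> b \<noteq> w" for a b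
  have to_root: "R\<^sup>*\<^sup>* a r" if "a \<noteq> w" "graph_dist E r a \<le> graph_dist E r w" for a
    using that
  proof (induction "graph_dist E r a" arbitrary: a rule: less_induct)
    case less
    show ?case
    proof (cases "a = r")
      case False
      then obtain b where b: "{b, a} \<in> E" "graph_dist E r a = Suc (graph_dist E r b)"
        by (rule graph_dist_predecessor[OF conn])
      then have "b \<noteq> w" using less.prems by auto
      then have "R a b" using b less.prems by (simp add: R_def insert_commute)
      moreover have "R\<^sup>*\<^sup>* b r" using b less.prems \<open>b \<noteq> w\<close> by (intro less.hyps) auto
      ultimately show ?thesis by (rule converse_rtranclp_into_rtranclp)
    qed simp
  qed
  have "symp R" by (auto simp: symp_def R_def insert_commute)
  then have "R\<^sup>*\<^sup>* r u'" using to_root[of u'] u' irrefl[OF u'(1)] by (metis symp_rtranclp sympD)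
  moreover have "R\<^sup>*\<^sup>* u r" using to_root[of u] u irrefl[OF u(1)] by metis
  ultimately have "R\<^sup>*\<^sup>* u u'" by (rule rtranclp_trans[rotated])
  then obtain xs0 where "rtrancl_path R u xs0 u'" unfolding rtranclp_eq_rtrancl_path by blast
  then obtain xs where xs: "rtrancl_path R u xs u'" "distinct (u # xs)" by (rule rtrancl_path_distinct)
  have walk: "successively (\<lambda>u v. {u, v} \<in> E) (u # xs)" "last (u # xs) = u'" "w \<notin> set xs"
    using walk_of_rtrancl_path[OF xs(1), of E w] by (auto simp: R_def)
  have "xs \<noteq> []" using walk(2) neq by auto
  then have "3 \<le> length (w # u # xs)" by (cases xs) simp_all
  moreover have "distinct (w # u # xs)" using xs(2) walk(3) irrefl[OF u(1)] by simp
  moreover have "walk E (w # u # xs)" using walk(1) u(1) by (simp add: walk_def)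
  moreover have "{last (w # u # xs), hd (w # u # xs)} \<in> E"
    using walk(2) u'(1) by (simp add: insert_commute)
  ultimately have "graph_cycle E (w # u # xs)" by (simp add: graph_cycle_def)
  then show False using T by (auto simp: tree_graph_def)
qed

text \<open>A vertex has at most one neighbour that is not farther from the root, so adjacent vertices lie on consecutive levels and
each edge joins a vertex to its unique parent. A vertex of maximal distance has no children and
is therefore a leaf of level \<open>h\<close>; this bounds all levels by \<open>h\<close>.\<close>

lemma perfect_binary_tree_structure:
  fixes E :: "'v::finite set set"
  assumes "perfect_binary_tree E r h"
  obtains par where "perfect_tree par (graph_dist E r) r h"
    "\<And>u v. {u, v} \<in> E \<longleftrightarrow> adj par (- {r}) u v"
proof -
  let ?d = "graph_dist E r"
  have T: "tree_graph E" and nonleaf: "\<And>v. \<not> leaf E r v \<Longrightarrow> card (children E r v) = 2"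
    and leaf: "\<And>v. leaf E r v \<Longrightarrow> ?d v = h"
    using assms by (simp_all add: perfect_binary_tree_def)
  have conn: "connected_graph E" using T by (simp add: tree_graph_def)
  have irrefl: "a \<noteq> b" if "{a, b} \<in> E" for a b
    using T that by (fastforce simp: tree_graph_def simple_graph_def)
  have "\<forall>v. \<exists>u. v \<noteq> r \<longrightarrow> {u, v} \<in> E \<and> ?d v = Suc (?d u)"
    using graph_dist_predecessor[OF conn] by metis
  then obtain par where par: "\<And>v. v \<noteq> r \<Longrightarrow> {par v, v} \<in> E" "\<And>v. v \<noteq> r \<Longrightarrow> ?d v = Suc (?d (par v))"
    by metis
  have below: "v \<noteq> r \<and> par v = u" if "{u, v} \<in> E" "?d u \<le> ?d v" for u v
  proof -
    have "v \<noteq> r"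
      using that graph_dist_self[of E r] graph_dist_zero[OF conn, of r u] irrefl[OF that(1)] by auto
    moreover from this have "par v = u"
      using acyclic_unique_predecessor[OF T, of v "par v" r u] par[of v] that by (simp add: insert_commute)
    ultimately show ?thesis by simp
  qed
  have edge: "{u, v} \<in> E \<longleftrightarrow> adj par (- {r}) u v" for u v
  proof
    assume uv: "{u, v} \<in> E"
    then have vu: "{v, u} \<in> E" by (simp add: insert_commute)
    show "adj par (- {r}) u v"
      using below[OF uv] below[OF vu] unfolding adj_def by (cases "?d u \<le> ?d v") auto
  next
    assume "adj par (- {r}) u v"
    then show "{u, v} \<in> E" using par(1)[of u] par(1)[of v] by (auto simp: adj_def insert_commute)
  qed
  have children: "children E r v = {w. w \<noteq> r \<and> par w = v}" for v
  proof (intro equalityI subsetI)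
    fix w assume "w \<in> children E r v"
    then have "{v, w} \<in> E" "?d v \<le> ?d w" by (simp_all add: children_def)
    then show "w \<in> {w. w \<noteq> r \<and> par w = v}" using below[of v w] by simp
  next
    fix w assume "w \<in> {w. w \<noteq> r \<and> par w = v}"
    then show "w \<in> children E r v" using par(1)[of w] par(2)[of w] by (auto simp: children_def)
  qed
  have le: "?d v \<le> h" for v
  proof -
    have "Max (range ?d) \<in> range ?d" by (intro Max_in) auto
    then obtain w where w: "Max (range ?d) = ?d w" by blast
    have max: "?d u \<le> ?d w" for u unfolding w[symmetric] by (intro Max_ge) auto
    have "children E r w = {}"
    proof (rule ccontr)
      assume "children E r w \<noteq> {}"
      then obtain c where "?d c = Suc (?d w)" by (auto simp: children_def)
      then show False using max[of c] by simp
    qed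
    then have "?d w = h" by (intro leaf) (simp add: leaf_def)
    then show ?thesis using max by simp
  qed
  have "perfect_tree par ?d r h"
  proof
    show "?d v = 0 \<longleftrightarrow> v = r" for v using graph_dist_zero[OF conn] graph_dist_self by metis
    show "card {w. w \<noteq> r \<and> par w = v} = 2" if "?d v < h" for v
      using nonleaf[of v] leaf[of v] that unfolding children by auto
  qed (use par le in auto)
  then show thesis using edge by (rule that)
qed

section \<open>Domination in perfect binary trees\<close>

context perfect_tree
begin

abbreviation "level j \<equiv> {v. lev v = j}"
abbreviation "kids v \<equiv> {w. w \<noteq> r \<and> par w = v}"

lemma lev_kid: "w \<in> kids v \<Longrightarrow> lev w = Suc (lev v)"
  using lev_par by auto

lemma ex_kid: "lev v < h \<Longrightarrow> \<exists>w. w \<in> kids v"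
  using children_2[of v] by (metis (no_types, lifting) card.empty empty_iff equals0I zero_neq_numeral)

lemma card_level: "j \<le> h \<Longrightarrow> card (level j) = 2 ^ j"
proof (induction j)
  case 0
  have "level 0 = {r}" using lev_zero_iff by auto
  then show ?case by simp
next
  case (Suc j)
  have "level (Suc j) = (\<Union>v\<in>level j. kids v)"
  proof (intro equalityI subsetI)
    fix w assume w: "w \<in> level (Suc j)"
    then have "w \<noteq> r" using lev_zero_iff[of w] by auto
    then show "w \<in> (\<Union>v\<in>level j. kids v)" using w lev_par[of w] by auto
  qed (use lev_kid in auto)
  then have "card (level (Suc j)) = (\<Sum>v\<in>level j. card (kids v))"
    by (simp only:) (rule card_UN_disjoint; auto)
  also have "\<dots> = (\<Sum>v\<in>level j. 2)" using Suc.prems by (intro sum.cong) (auto intro: children_2)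
  finally show ?case using Suc by simp
qed

lemma card_levels:
  assumes "J \<subseteq> {..h}"
  shows "card {v. lev v \<in> J} = (\<Sum>j\<in>J. 2 ^ j)"
proof -
  have "{v. lev v \<in> J} = (\<Union>j\<in>J. level j)" by auto
  moreover have "finite J" using assms by (rule finite_subset) simp
  ultimately have "card {v. lev v \<in> J} = (\<Sum>j\<in>J. card (level j))"
    by (simp only:) (rule card_UN_disjoint; auto)
  also have "\<dots> = (\<Sum>j\<in>J. 2 ^ j)" using assms by (intro sum.cong card_level) auto
  finally show ?thesis .
qed

lemma adj_lev: "adj par (- {r}) u v \<Longrightarrow> lev u = Suc (lev v) \<or> lev v = Suc (lev u)"
  using lev_par by (auto simp: adj_def)

lemma card_UNIV_tree: "card (UNIV :: 'v set) + 1 = 2 ^ Suc h"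
proof -
  have "card {v. lev v \<in> {..h}} = (\<Sum>j\<in>{..h}. 2 ^ j)" by (rule card_levels) simp
  moreover have "{v. lev v \<in> {..h}} = UNIV" using lev_le by auto
  moreover have "(\<Sum>j\<le>h. 2 ^ j) + 1 = (2::nat) ^ Suc h" by (induction h) simp_all
  ultimately show ?thesis by simp
qed

end

lemma mod3_shift_unique:
  fixes a c i j :: nat
  assumes "a mod 3 = c mod 3" "a + i = c + j" "i \<le> 2" "j \<le> 2"
  shows "i = j"
proof -
  have "int c mod 3 = int a mod 3" using arg_cong[OF assms(1), of int] by (simp add: zmod_int)
  then have "3 dvd int c - int a" by (simp only: mod_eq_dvd_iff)
  moreover have "int c - int a = int i - int j" using assms(2) by linarith
  ultimately obtain q where q: "int i - int j = 3 * q" by (auto elim: dvdE)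
  then have "q < 1" "- 1 < q" using assms(3,4) by linarith+
  then show ?thesis using q by simp
qed

text \<open>The three cases of the height are treated at once by \<open>h + 2 = 3 k + s\<close>: then \<open>s + 3 i\<close> for \<open>i < k\<close> are the levels
\<open>h - 1\<close>, \<open>h - 4\<close>, and so on, down to level \<open>s\<close>, and \<open>s = 2\<close> means that \<open>3\<close> divides \<open>h\<close>.\<close>

locale perfect_tree_mod3 = perfect_tree par lev r h
  for par :: "'v::finite \<Rightarrow> 'v" and lev r h +
  fixes k s :: nat
  assumes h: "h + 2 = 3 * k + s" and s: "s < 3" and h_pos: "0 < h"
begin

definition "S = (\<lambda>i. 3 * i + s) ` {..<k}"
text \<open>\<open>Y\<close> turns out to be a smallest possible set of undominated vertices. When \<open>3\<close> divides \<open>h\<close>, the lowest level in \<open>S\<close> is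
\<open>2\<close>, and the root has no neighbour there.\<close>

definition "Y = {v. lev v \<in> S} \<union> (if 3 dvd h then {r} else {})"

lemma S_iff: "j \<in> S \<longleftrightarrow> j < h \<and> j mod 3 = s"
proof
  assume "j \<in> S"
  then obtain i where "i < k" "j = 3 * i + s" by (auto simp: S_def)
  then show "j < h \<and> j mod 3 = s" using h s by simp
next
  assume j: "j < h \<and> j mod 3 = s"
  then have "j = 3 * (j div 3) + s" by (metis mult_div_mod_eq)
  moreover from this have "j div 3 < k" using j h by linarith
  ultimately show "j \<in> S" unfolding S_def by blast
qed

lemma dvd_h: "3 dvd h \<longleftrightarrow> s = 2"
  using h s by presburger

lemma card_Y: "7 * card Y + 2 ^ s = 2 ^ s * 8 ^ k + (if 3 dvd h then 7 else 0)"
proof -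
  have inj: "inj_on (\<lambda>i. 3 * i + s) {..<k}" by (auto simp: inj_on_def)
  have "card {v. lev v \<in> S} = (\<Sum>j\<in>S. 2 ^ j)"
  proof (rule card_levels, rule subsetI)
    fix j assume "j \<in> S"
    then have "j < h" unfolding S_iff by (rule conjunct1)
    then show "j \<in> {..h}" by simp
  qed
  also have "\<dots> = (\<Sum>i<k. 2 ^ (3 * i + s))"
    unfolding S_def sum.reindex[OF inj] comp_def by (rule refl)
  also have "\<dots> = 2 ^ s * (\<Sum>i<k. 8 ^ i)"
  proof -
    have "(2::nat) ^ (3 * i + s) = 2 ^ s * 8 ^ i" for i
      by (subst power_add, subst power_mult) simp
    then show ?thesis by (simp add: sum_distrib_left)
  qed
  finally have card_S: "card {v. lev v \<in> S} = 2 ^ s * (\<Sum>i<k. 8 ^ i)" .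
  have geo: "7 * (\<Sum>i<k. 8 ^ i) + 1 = (8::nat) ^ k" by (induction k) simp_all
  have "7 * card {v. lev v \<in> S} + 2 ^ s = 2 ^ s * (7 * (\<Sum>i<k. 8 ^ i) + 1)"
    unfolding card_S by (simp add: distrib_left)
  then have S: "7 * card {v. lev v \<in> S} + 2 ^ s = 2 ^ s * 8 ^ k" by (simp only: geo)
  have "card Y = card {v. lev v \<in> S} + (if 3 dvd h then 1 else 0)"
  proof (cases "3 dvd h")
    case True
    then have "0 \<notin> S" unfolding S_iff dvd_h by simp
    moreover have "lev r = 0" using lev_zero_iff by blast
    ultimately have "r \<notin> {v. lev v \<in> S}" by simp
    then have "card (insert r {v. lev v \<in> S}) = Suc (card {v. lev v \<in> S})" by simp
    moreover have "Y = insert r {v. lev v \<in> S}" unfolding Y_def using True by auto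
    ultimately show ?thesis using True by simp
  next
    case False
    then have "Y = {v. lev v \<in> S}" unfolding Y_def by simp
    then show ?thesis using False by simp
  qed
  then show ?thesis using S by (simp split: if_splits)
qed

definition "A = {v. lev v \<in> S}"

lemma indep_A: "indep par (- {r}) A"
  unfolding indep_def
proof (intro ballI notI)
  fix a b assume ab: "a \<in> A" "b \<in> A" "adj par (- {r}) a b"
  have "lev a mod 3 = lev b mod 3" using ab(1,2) unfolding A_def mem_Collect_eq S_iff by simp
  moreover have "Suc j mod 3 \<noteq> j mod 3" for j :: nat by (simp add: mod_Suc)
  ultimately show False using adj_lev[OF ab(3)] by metis
qed

text \<open>Each level outside \<open>S\<close> is next to one in \<open>S\<close>: a vertex just below a level of \<open>S\<close> is dominated by its
parent and one just above by its children. As \<open>S\<close> contains \<open>h - 1\<close> and every third level from there towards the root, the only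
exception is level \<open>0\<close> when \<open>S\<close> starts at level \<open>2\<close>.\<close>

lemma nbhd_A: "- Y \<subseteq> nbhd par (- {r}) A"
proof
  fix v assume v: "v \<in> - Y"
  then have vS: "lev v \<notin> S" and vr: "3 dvd h \<Longrightarrow> v \<noteq> r" by (auto simp: Y_def)
  show "v \<in> nbhd par (- {r}) A"
  proof (cases "lev v \<noteq> 0 \<and> lev v - 1 \<in> S")
    case True
    then have "v \<noteq> r" using lev_zero_iff by auto
    then have "adj par (- {r}) (par v) v" "par v \<in> A"
      using True lev_par[of v] by (auto simp: adj_def A_def)
    then show ?thesis by (auto simp: nbhd_def)
  next
    case False
    have "lev v \<le> h" by (rule lev_le)
    have mod_S: "j mod 3 = s" if "j + 3 = 3 * k + s" for j
    proof -
      have "(j + 3) mod 3 = (3 * k + s) mod 3" using that by (rule arg_cong)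
      then show ?thesis using s by simp
    qed
    have mod_h: "j mod 3 \<noteq> s" if "j \<notin> S" "j < h" for j using that by (simp add: S_iff)
    have "lev v + 1 < h \<and> (lev v + 1) mod 3 = s"
    proof (cases "lev v")
      case 0
      then have "s \<noteq> 2" using vr lev_zero_iff dvd_h by blast
      moreover have "s \<noteq> 0" using mod_h[OF vS] 0 h_pos by auto
      ultimately have "s = 1" using s by simp
      moreover have "h \<noteq> 1" using h \<open>s = 1\<close> by presburger
      ultimately show ?thesis using 0 h_pos by simp
    next
      case (Suc l)
      then have l: "l mod 3 \<noteq> s" using False mod_h[of l] \<open>lev v \<le> h\<close> by simp
      then have "lev v \<noteq> h" using mod_S[of l] Suc h by auto
      then have lt: "lev v < h" using \<open>lev v \<le> h\<close> by simp
      then have l': "lev v mod 3 \<noteq> s" using mod_h[OF vS] by simp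
      then have "lev v + 1 \<noteq> h" using mod_S[of "lev v"] h by auto
      moreover have "(lev v + 1) mod 3 = s" 
        using l l' s mod_less_divisor[of 3 l] by (auto simp: Suc mod_Suc split: if_splits)
      ultimately show ?thesis using lt by simp
    qed
    then have "lev v < h \<and> Suc (lev v) \<in> S" by (simp add: S_iff)
    moreover from this obtain w where "w \<in> kids v" using ex_kid by blast
    ultimately have "adj par (- {r}) w v" "w \<in> A" using lev_kid by (auto simp: adj_def A_def)
    then show ?thesis by (auto simp: nbhd_def)
  qed
qed

text \<open>For \<open>y\<close> on a level of \<open>S\<close> the block consists of \<open>y\<close> and all vertices one or two levels below it,
and so contains the closed neighbourhood of each child of \<open>y\<close>. The other case
occurs for the root only, whose block is its closed neighbourhood.\<close>

definition "block y = (if lev y \<in> S then {b. \<exists>i\<le>2. lev b = lev y + i \<and> (par ^^ i) b = y}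
  else {b. lev b \<le> 1})"

lemma blocks_disjoint:
  assumes y: "y \<in> Y" "y' \<in> Y" and b: "b \<in> block y" "b \<in> block y'"
  shows "y = y'"
proof -
  have root: "z = r \<and> 3 dvd h" if "z \<in> Y" "lev z \<notin> S" for z
    using that by (auto simp: Y_def split: if_splits)
  have mixed: False if "lev z \<in> S" "z' \<in> Y" "lev z' \<notin> S" "b \<in> block z" "b \<in> block z'" for z z'
  proof -
    have "3 dvd h" "lev b \<le> 1" using root[OF that(2,3)] that(3,5) by (simp_all add: block_def)
    moreover have "lev z \<le> lev b" using that(1,4) by (auto simp: block_def)
    moreover have "lev z mod 3 = s" using that(1) S_iff by blast
    ultimately show False using dvd_h by presburger
  qed
  show ?thesis
  proof (cases "lev y \<in> S"; cases "lev y' \<in> S")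
    assume S: "lev y \<in> S" "lev y' \<in> S"
    obtain i where i: "i \<le> 2" "lev b = lev y + i" "(par ^^ i) b = y"
      using b(1) S by (auto simp: block_def)
    obtain i' where i': "i' \<le> 2" "lev b = lev y' + i'" "(par ^^ i') b = y'"
      using b(2) S by (auto simp: block_def)
    have "lev y mod 3 = lev y' mod 3" using S by (simp add: S_iff)
    moreover have "lev y + i = lev y' + i'" using i(2) i'(2) by simp
    ultimately have "i = i'" using i(1) i'(1) by (rule mod3_shift_unique)
    then show ?thesis using i(3) i'(3) by simp
  qed (use root y mixed b in blast)+
qed

text \<open>Let \<open>c\<close> be a child of \<open>y\<close>. Either \<open>c\<close> itself is not dominated by \<open>B\<close>, or it has a neighbour in \<open>B\<close>, which is not dominated
because \<open>B\<close> is independent. For the root, the root itself takes the part of \<open>c\<close>.\<close>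

lemma block_meets:
  assumes indep: "indep par (- {r}) B" and y: "y \<in> Y"
  shows "\<exists>b. b \<in> block y \<and> b \<notin> nbhd par (- {r}) B"
proof -
  have B: "b \<notin> nbhd par (- {r}) B" if "b \<in> B" for b
    using indep that by (auto simp: nbhd_def indep_def)
  show ?thesis
  proof (cases "lev y \<in> S")
    case True
    then have "lev y < h" by (simp add: S_iff)
    then obtain c where c: "c \<in> kids y" using ex_kid by blast
    have c_block: "c \<in> block y"
      using True c lev_kid[OF c] by (auto simp: block_def intro!: exI[of _ 1])
    show ?thesis
    proof (cases "c \<in> nbhd par (- {r}) B")
      case False
      with c_block show ?thesis by blast
    next
      case True': True
      then obtain b where b: "b \<in> B" "adj par (- {r}) b c" by (auto simp: nbhd_def)
      then have "b = y \<or> b \<in> kids c" using c by (auto simp: adj_def)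
      then have "b \<in> block y"
      proof
        assume "b = y"
        then show ?thesis using True by (auto simp: block_def intro!: exI[of _ 0])
      next
        assume "b \<in> kids c"
        then have "lev b = lev y + 2" "(par ^^ 2) b = y"
          using lev_kid[OF c] lev_kid[of b c] c by (auto simp: numeral_2_eq_2)
        then show ?thesis using True by (auto simp: block_def)
      qed
      then show ?thesis using B[OF b(1)] by blast
    qed
  next
    case False
    then have yr: "y = r" using y by (auto simp: Y_def split: if_splits)
    show ?thesis
    proof (cases "r \<in> nbhd par (- {r}) B")
      case True
      then obtain b where b: "b \<in> B" "adj par (- {r}) b r" by (auto simp: nbhd_def)
      then have "lev b \<le> 1" using adj_lev[OF b(2)] lev_zero_iff[of r] by auto
      then show ?thesis using B[OF b(1)] False by (auto simp: block_def)
    next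
      case False': False
      have "r \<in> block y" using False lev_zero_iff[of r] by (simp add: block_def)
      with False' show ?thesis by blast
    qed
  qed
qed

text \<open>Choosing an undominated vertex in each block is injective, so that every independent set leaves at least \<open>card Y\<close> vertices
undominated, while \<open>A\<close> dominates everything outside \<open>Y\<close>.\<close>

lemma dominated_max_eq:
  assumes "dominated_max par (- {r}) n"
  shows "n + card Y = card (UNIV :: 'v set)"
proof -
  obtain B where B: "indep par (- {r}) B" "n \<le> card (nbhd par (- {r}) B)"
    using assms by (auto simp: dominated_max_def)
  obtain f where f: "\<And>y. y \<in> Y \<Longrightarrow> f y \<in> block y" "\<And>y. y \<in> Y \<Longrightarrow> f y \<notin> nbhd par (- {r}) B"
    using block_meets[OF B(1)] by metis
  have "inj_on f Y" using blocks_disjoint f(1) by (metis inj_onI)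
  then have "card Y \<le> card (- nbhd par (- {r}) B)"
    using f(2) by (intro card_inj_on_le) auto
  then have "n + card Y \<le> card (nbhd par (- {r}) B) + card (- nbhd par (- {r}) B)"
    using B(2) by simp
  also have "\<dots> = card (UNIV :: 'v set)"
    by (subst card_Un_disjoint[symmetric]) auto
  finally have "n + card Y \<le> card (UNIV :: 'v set)" .
  moreover have "card (- Y) \<le> n"
    using assms indep_A card_mono[OF finite nbhd_A] unfolding dominated_max_def by (meson le_trans)
  moreover have "card Y + card (- Y) = card (UNIV :: 'v set)"
    by (subst card_Un_disjoint[symmetric]) auto
  ultimately show ?thesis by simp
qed

lemma dominated_max_value:
  assumes "dominated_max par (- {r}) n"
  shows "7 * n + 2 ^ s * 8 ^ k + (if 3 dvd h then 7 else 0) + 7 = 14 * 2 ^ h + 2 ^ s"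
  using dominated_max_eq[OF assms] card_UNIV_tree card_Y by (simp split: if_splits)

end

section \<open>Projective dimension of perfect binary trees\<close>

lemma edge_ideal_eq:
  fixes E :: "'v::finite set set"
  assumes "simple_graph E" and adj: "\<And>u v. {u, v} \<in> E \<longleftrightarrow> adj par X u v"
  shows "(edge_ideal E :: ('v, 'k::field) mpoly set) = monomial_ideal (cover_exponents par X {})"
proof -
  let ?M = "{Poly_Mapping.single u 1 + Poly_Mapping.single v (1::nat) | u v. {u, v} \<in> E}"
  have "{Var u * Var v | u v. {u, v} \<in> E} = ((\<lambda>s. Poly_Mapping.single s 1) ` ?M :: ('v, 'k) mpoly set)"
    by (auto simp: Var_def mult_single)
  then have "(edge_ideal E :: ('v, 'k) mpoly set) = monomial_ideal {s + t | s t. s \<in> ?M}"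
    unfolding edge_ideal_def by (simp only: Idl_monomials)
  also have "{s + t | s t. s \<in> ?M} = cover_exponents par X {}"
  proof -
    have "{s + t | s t. s \<in> ?M} =
        {t. \<exists>u v. {u, v} \<in> E \<and> t \<in> range ((+) (Poly_Mapping.single u 1 + Poly_Mapping.single v 1))}"
      by blast
    also have "\<dots> = {t. \<exists>u v. {u, v} \<in> E \<and> Poly_Mapping.lookup t u \<noteq> 0 \<and> Poly_Mapping.lookup t v \<noteq> 0}"
    proof -
      have "u \<noteq> v" if "{u, v} \<in> E" for u v using assms(1) that by (fastforce simp: simple_graph_def)
      then show ?thesis using single_add_single_range_iff by (metis (no_types, lifting))
    qed
    finally show ?thesis by (simp add: cover_exponents_def adj)
  qed
  finally show ?thesis .
qed

lemma upward_closed_cover_exponents: "upward_closed (cover_exponents par X W)"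
  unfolding upward_closed_def cover_exponents_def by (fastforce simp: lookup_add)

theorem theorem1p3:
  fixes E :: "'v::finite set set" and r :: 'v and h m :: nat
    and I :: "('v, 'k::field) mpoly set"
  assumes "perfect_binary_tree E r h"
    and "h > 0"
    and "I = edge_ideal E"
  shows "(h = 3 * m \<longrightarrow> real (proj_dim_quotient I) = 10 * (8 ^ m - 1) / 7) \<and>
    (h = 3 * m + 1 \<longrightarrow> real (proj_dim_quotient I) = (20 * 8 ^ m - 6) / 7) \<and>
    (h = 3 * m + 2 \<longrightarrow> real (proj_dim_quotient I) = (40 * 8 ^ m - 5) / 7)"
proof -
  obtain par where T: "perfect_tree par (graph_dist E r) r h"
    and adj: "\<And>u v. {u, v} \<in> E \<longleftrightarrow> adj par (- {r}) u v"
    using perfect_binary_tree_structure[OF assms(1)] by blast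
  have "graph_dist E r (par v) < graph_dist E r v" if "v \<in> - {r}" for v
    using perfect_tree.lev_par[OF T, of v] that by simp
  from forest_resolvable[of "- {r}" "graph_dist E r" par, OF this] obtain n where n: "dominated_max par (- {r}) n"
    "resolvable (monomial_ideal (cover_exponents par (- {r}) {}) :: ('v, 'k) mpoly set) n"
    by blast
  have "simple_graph E" using assms(1) by (simp add: perfect_binary_tree_def tree_graph_def)
  from edge_ideal_eq[OF this adj] have I: "I = monomial_ideal (cover_exponents par (- {r}) {})"
    by (simp only: assms(3))
  have "ideal I class_ring"
    unfolding I by (rule ideal_monomial_ideal[OF upward_closed_cover_exponents])
  moreover obtain b a D where "ideal_resolution I b a D" "resolution_length b n"
    using n(2) unfolding resolvable_def I by blast
  ultimately have pd: "proj_dim_quotient I = n" by (rule proj_dim_quotient_eqI)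
  have seven_n: "7 * n + 2 ^ s * 8 ^ k + (if 3 dvd h then 7 else 0) + 7 = 14 * 2 ^ h + 2 ^ s"
    if "h + 2 = 3 * k + s" "s < 3" for k s
  proof -
    interpret perfect_tree par "graph_dist E r" r h by (rule T)
    interpret perfect_tree_mod3 par "graph_dist E r" r h k s
      by unfold_locales (rule that assms(2))+
    show ?thesis by (rule dominated_max_value[OF n(1)])
  qed
  have pow: "(2::nat) ^ (3 * m) = 8 ^ m" by (subst power_mult) simp
  show ?thesis
    unfolding pd
  proof (intro conjI impI)
    assume h: "h = 3 * m"
    \<comment> \<open>Here \<open>h + 2 = 3 m + 2\<close>; in the other two cases \<open>k = m + 1\<close> is right.\<close>
    from seven_n[of m 2] have "7 * n + 10 = 10 * 8 ^ m" by (simp add: h pow)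
    then have "real (7 * n + 10) = real (10 * 8 ^ m)" by (rule arg_cong)
    then show "real n = 10 * (8 ^ m - 1) / 7" by simp
  next
    assume h: "h = 3 * m + 1"
    then have "\<not> 3 dvd h" by presburger
    with seven_n[of "Suc m" 0] have "7 * n + 6 = 20 * 8 ^ m" by (simp add: h pow)
    then have "real (7 * n + 6) = real (20 * 8 ^ m)" by (rule arg_cong)
    then show "real n = (20 * 8 ^ m - 6) / 7" by simp
  next
    assume h: "h = 3 * m + 2"
    then have "\<not> 3 dvd h" by presburger
    with seven_n[of "Suc m" 1] have "7 * n + 5 = 40 * 8 ^ m" by (simp add: h pow)
    then have "real (7 * n + 5) = real (40 * 8 ^ m)" by (rule arg_cong)
    then show "real n = (40 * 8 ^ m - 5) / 7" by simp
  qed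
qed

end
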